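(* Let $\tau:A\to A^+$ be a one-to-one primitive substitution of constant length $p\ge2$ such that $X_\tau$ is not finite. Then the system $(X_\tau,T)$ has Li–Yorke pairs if and only if there exist $m\in\mathbb N$ and $a,b\in A$, $a\neq b$, such that $\tau^m(a)=uav$ and $\tau^m(b)=u'bv'$ with (possibly empty) words $u,u',v,v'$ satisfying $|u|=|u'|$, $|v|=|v'|$, $v\ne v'$, and $v$ coincides in at least one coordinate with $v'$.
   Context: $\mathbb N$ is the set of non-negative integers. A substitution is a map $\tau:A\to A^+$, where $A$ is a finite set and $A^+$ is the set of non-empty finite words over $A$; it is extended to $A^+$ by concatenation. It has constant length $p$ if $|\tau(a)|=p$ for all $a\in A$, is one-to-one if $\tau(a)\neq\tau(b)$ for $a\ne b$ in $A$, and is primitive if there is $n$ such that $a$ appears in $\tau^n(b)$ for all $a,b\in A$. The shift is $T((x_i)_i)=(x_{i+1})_i$. $X_\tau$ is the smallest subshift (closed shift-invariant subset) of $A^{\mathbb Z}$ in which all words $\tau^n(a)$, $n\in\mathbb N$, $a\in A$, appear; fix a metric $\varrho$ compatible with its topology. A pair $\{x,y\}$ is a Li–Yorke pair if $\limsup_{n\to\infty}\varrho(T^nx,T^ny)>0$ and $\liminf_{n\to\infty}\varrho(T^nx,T^ny)=0$. *)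

theory Defs
  imports "HOL-Analysis.Analysis"
begin

text \<open>The alphabet is a type of class \<open>finite\<close>, words are lists, and points of the full shift are
  functions on \<open>int\<close>.\<close>

type_synonym 'a substitution = "'a \<Rightarrow> 'a list"

definition is_substitution :: "'a substitution \<Rightarrow> bool" where
  "is_substitution \<tau> \<longleftrightarrow> (\<forall>a. \<tau> a \<noteq> [])"

definition extend :: "'a substitution \<Rightarrow> 'a list \<Rightarrow> 'a list" where
  "extend \<tau> w = concat (map \<tau> w)"

definition iterate :: "'a substitution \<Rightarrow> nat \<Rightarrow> 'a \<Rightarrow> 'a list" where
  "iterate \<tau> n a = (extend \<tau> ^^ n) [a]"

definition constant_length :: "'a substitution \<Rightarrow> nat \<Rightarrow> bool" where
  "constant_length \<tau> p \<longleftrightarrow> (\<forall>a. length (\<tau> a) = p)"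

definition primitive :: "'a substitution \<Rightarrow> bool" where
  "primitive \<tau> \<longleftrightarrow> (\<exists>n. \<forall>a b. a \<in> set (iterate \<tau> n b))"

definition shift :: "(int \<Rightarrow> 'a) \<Rightarrow> (int \<Rightarrow> 'a)" where
  "shift x = (\<lambda>i. x (i + 1))"

definition full_shift_topology :: "(int \<Rightarrow> 'a) topology" where
  "full_shift_topology = product_topology (\<lambda>_. discrete_topology UNIV) UNIV"

definition subshift :: "(int \<Rightarrow> 'a) set \<Rightarrow> bool" where
  "subshift X \<longleftrightarrow> closedin full_shift_topology X \<and> shift ` X = X"

definition appears_in :: "'a list \<Rightarrow> (int \<Rightarrow> 'a) set \<Rightarrow> bool" where
  "appears_in w X \<longleftrightarrow> (\<exists>x\<in>X. \<exists>i. \<forall>j<length w. x (i + int j) = w ! j)"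

text \<open>The smallest subshift in which all words \<open>iterate \<tau> n a\<close> occur, as the intersection of all
  of them. For arbitrary \<open>\<tau>\<close> this intersection need not itself contain these words; for primitive
  \<open>\<tau>\<close> it does: the points all of whose finite factors occur in some \<open>iterate \<tau> n a\<close> form a
  minimal subshift in which all these words occur, and by compactness every subshift with these
  words meets it, hence contains it.\<close>

definition substitution_subshift :: "'a substitution \<Rightarrow> (int \<Rightarrow> 'a) set" where
  "substitution_subshift \<tau> = \<Inter>{X. subshift X \<and> (\<forall>n a. appears_in (iterate \<tau> n a) X)}"

text \<open>A metric on \<open>X\<close> inducing the topology \<open>X\<close> inherits from the full shift.\<close>

definition compatible_metric ::
    "(int \<Rightarrow> 'a) set \<Rightarrow> ((int \<Rightarrow> 'a) \<Rightarrow> (int \<Rightarrow> 'a) \<Rightarrow> real) \<Rightarrow> bool" where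
  "compatible_metric X \<rho> \<longleftrightarrow>
     Metric_space X \<rho> \<and> Metric_space.mtopology X \<rho> = subtopology full_shift_topology X"

text \<open>The limits are taken in \<open>ereal\<close> so that both always exist.\<close>

definition Li_Yorke_pair ::
    "((int \<Rightarrow> 'a) \<Rightarrow> (int \<Rightarrow> 'a) \<Rightarrow> real) \<Rightarrow> (int \<Rightarrow> 'a) \<Rightarrow> (int \<Rightarrow> 'a) \<Rightarrow> bool" where
  "Li_Yorke_pair \<rho> x y \<longleftrightarrow>
     limsup (\<lambda>n. ereal (\<rho> ((shift ^^ n) x) ((shift ^^ n) y))) > 0 \<and>
     liminf (\<lambda>n. ereal (\<rho> ((shift ^^ n) x) ((shift ^^ n) y))) = 0"

end

theory Submission
  imports Defs
begin

text \<open>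
  Write \<open>X\<close> for the subshift of \<open>\<tau>\<close>. By compactness, every compatible metric is uniformly
  equivalent to comparing windows around \<open>0\<close>, so a Li--Yorke pair is a pair of points that differ
  infinitely often to the right and that agree on arbitrarily long blocks to the right
  (\<open>Li_Yorke_pair_iff\<close>). The metric then disappears from the argument.

  Suppose that \<open>\<tau>\<^sup>m\<close> carries \<open>a\<close> and \<open>b\<close> to words which contain \<open>a\<close>, respectively \<open>b\<close>, at the
  same place, and which to the right of that place agree at one position and differ at another.
  Iterating \<open>\<tau>\<^sup>m\<close> around this place gives two points of \<open>X\<close> whose right halves are fixed. The
  position of agreement grows into arbitrarily long blocks of agreement, and by injectivity the position
  of difference never dies out (\<open>forward_Li_Yorke_from_letters\<close>).

  For the converse, the essential input is that the position of a point of \<open>X\<close> inside the blocks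
  of \<open>\<tau>\<close> is determined by the point (\<open>recognizability\<close>). If \<open>T\<^sup>i \<tau>(u) = T\<^sup>j \<tau>(w)\<close> for
  points \<open>u\<close>, \<open>w\<close> of \<open>X\<close> and \<open>i \<noteq> j\<close> modulo \<open>p\<close>, then minimality yields \<open>T\<^sup>i \<tau>(X) \<subseteq> T\<^sup>j \<tau>(X)\<close>, so that \<open>p - 1\<close> of the sets
  \<open>T\<^sup>k \<tau>(X)\<close> cover \<open>X\<close>. Iterating, \<open>X\<close> is covered by at most \<open>(p - 1)\<^sup>n\<close> sets \<open>T\<^sup>k \<tau>\<^sup>n(X)\<close>, and
  each of them contributes at most \<open>|A|\<^sup>2\<close> words of length \<open>p\<^sup>n\<close>. But an infinite subshift has
  more than \<open>p\<^sup>n\<close> words of this length, a contradiction for large \<open>n\<close>.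

  Now let \<open>x\<close>, \<open>y\<close> be a Li--Yorke pair. Since \<open>x\<close> and \<open>y\<close> agree on long blocks, compactness and
  recognizability show that they are cut into blocks of \<open>\<tau>\<close> at the same places, and the pair of
  preimages is again a Li--Yorke pair (\<open>forward_Li_Yorke_desubstitute\<close>). Hence \<open>x\<close> and \<open>y\<close> can be
  desubstituted indefinitely and in parallel. Fix a position at which \<open>x\<close> and \<open>y\<close> differ and follow
  the pairs of letters above it; all of them are pairs of distinct letters, so some pair \<open>(a, b)\<close>
  occurs on two levels \<open>k < l\<close>, and the word of \<open>\<tau>\<^bsup>l - k\<^esup>\<close> below the upper occurrence contains
  the lower one. If the part of this word to the right of the lower occurrence is long enough, it
  reaches both an agreement and a difference of the pair on level \<open>k\<close>, which is what is wanted. The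
  position can be chosen such that these parts get arbitrarily long: if they stay short for one
  position on infinitely many levels, then on these levels a later position lies close to the left
  end of the next block (\<open>letters_from_forward_Li_Yorke\<close>).
\<close>

section \<open>Topology of the full shift\<close>

text \<open>The windows \<open>{-N..N}\<close> form a neighbourhood base of the full shift, so all topology below
  is phrased through agreement on them.\<close>

definition agree_upto :: "int \<Rightarrow> (int \<Rightarrow> 'b) \<Rightarrow> (int \<Rightarrow> 'b) \<Rightarrow> bool" where
  "agree_upto N x y \<longleftrightarrow> (\<forall>t. \<bar>t\<bar> \<le> N \<longrightarrow> x t = y t)"

lemma agree_uptoD: "agree_upto N x y \<Longrightarrow> \<bar>t\<bar> \<le> N \<Longrightarrow> x t = y t"
  by (simp add: agree_upto_def)

lemma agree_upto_sym: "agree_upto N x y \<Longrightarrow> agree_upto N y x"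
  by (simp add: agree_upto_def)

lemma agree_upto_trans: "agree_upto N x y \<Longrightarrow> agree_upto N y z \<Longrightarrow> agree_upto N x z"
  by (simp add: agree_upto_def)

lemma agree_upto_mono: "agree_upto N x y \<Longrightarrow> M \<le> N \<Longrightarrow> agree_upto M x y"
  by (simp add: agree_upto_def)

lemma openin_full_shift_iff:
  "openin full_shift_topology S \<longleftrightarrow> (\<forall>x\<in>S. \<exists>N. \<forall>y. agree_upto N x y \<longrightarrow> y \<in> S)"
proof
  assume S: "openin full_shift_topology S"
  show "\<forall>x\<in>S. \<exists>N. \<forall>y. agree_upto N x y \<longrightarrow> y \<in> S"
  proof
    fix x assume "x \<in> S"
    with S obtain U where fin: "finite {i. U i \<noteq> UNIV}"
      and x: "x \<in> Pi\<^sub>E UNIV U" and sub: "Pi\<^sub>E UNIV U \<subseteq> S"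
      unfolding full_shift_topology_def openin_product_topology_alt by (force simp: UNIV_def[symmetric])
    define N where "N = Max (insert 0 (abs ` {i. U i \<noteq> UNIV}))"
    have N: "\<bar>i\<bar> \<le> N" if "U i \<noteq> UNIV" for i
      unfolding N_def using fin that by (intro Max_ge) auto
    have "y \<in> S" if y: "agree_upto N x y" for y
    proof -
      have "y i \<in> U i" for i
        using x N[of i] agree_uptoD[OF y, of i] by (metis PiE_mem UNIV_I)
      with sub show ?thesis by (auto simp: PiE_iff)
    qed
    then show "\<exists>N. \<forall>y. agree_upto N x y \<longrightarrow> y \<in> S" by blast
  qed
next
  assume R: "\<forall>x\<in>S. \<exists>N. \<forall>y. agree_upto N x y \<longrightarrow> y \<in> S"
  show "openin full_shift_topology S"
    unfolding full_shift_topology_def openin_product_topology_alt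
  proof
    fix x assume "x \<in> S"
    with R obtain N where N: "\<And>y. agree_upto N x y \<Longrightarrow> y \<in> S" by blast
    define U where "U = (\<lambda>i. if \<bar>i\<bar> \<le> N then {x i} else UNIV)"
    have "{i. U i \<noteq> UNIV} \<subseteq> {-N..N}" by (auto simp: U_def split: if_splits)
    then have "finite {i. U i \<noteq> UNIV}" using finite_subset by blast
    moreover have "x \<in> Pi\<^sub>E UNIV U" by (auto simp: U_def PiE_iff)
    moreover have "Pi\<^sub>E UNIV U \<subseteq> S"
    proof
      fix y assume "y \<in> Pi\<^sub>E UNIV U"
      then have "\<And>t. y t \<in> U t" by (auto simp: PiE_iff)
      then have "agree_upto N x y" unfolding agree_upto_def U_def
        by (metis (full_types) singletonD)
      then show "y \<in> S" by (rule N)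
    qed
    ultimately show "\<exists>U. finite {i \<in> UNIV. U i \<noteq> topspace (discrete_topology UNIV)} \<and>
             (\<forall>i\<in>UNIV. openin (discrete_topology UNIV) (U i)) \<and>
             x \<in> Pi\<^sub>E UNIV U \<and> Pi\<^sub>E UNIV U \<subseteq> S"
      by auto
  qed
qed

lemma topspace_full_shift [simp]: "topspace full_shift_topology = UNIV"
  by (simp add: full_shift_topology_def)

lemma closedin_full_shift_iff:
  "closedin full_shift_topology X \<longleftrightarrow> (\<forall>x. (\<forall>N. \<exists>y\<in>X. agree_upto N x y) \<longrightarrow> x \<in> X)"
  unfolding closedin_def openin_full_shift_iff by simp blast

lemma closedin_full_shift_singleton: "closedin full_shift_topology {z}"
  unfolding closedin_full_shift_iff
proof (intro allI impI)
  fix x assume *: "\<forall>N::int. \<exists>y\<in>{z}. agree_upto N x y"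
  have "x t = z t" for t using *[rule_format, of "\<bar>t\<bar>"] by (auto simp: agree_upto_def)
  then show "x \<in> {z}" by auto
qed

text \<open>Sequential compactness, by the diagonal argument: infinite index sets \<open>S N\<close> decrease in
  \<open>N\<close>, and all \<open>u k\<close> with \<open>k \<in> S N\<close> agree up to \<open>N\<close>. The values range over a finite set rather
  than a finite type, because below numbers are carried along as additional coordinates.\<close>

lemma full_shift_limit_point:
  fixes u :: "nat \<Rightarrow> int \<Rightarrow> 'b"
  assumes F: "finite F" and u: "\<And>k t. u k t \<in> F"
  shows "\<exists>x. \<forall>N. \<exists>k\<ge>N. agree_upto (int N) x (u k)"
proof -
  define P where "P = (\<lambda>N S. infinite S \<and> (\<forall>k\<in>S. \<forall>l\<in>S. agree_upto (int N) (u k) (u l)))"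
  have step: "\<exists>S'. P N S' \<and> S' \<subseteq> S" if S: "infinite S" for N and S :: "nat set"
  proof -
    define f where "f = (\<lambda>k. restrict (u k) {-int N..int N})"
    have "f ` S \<subseteq> {-int N..int N} \<rightarrow>\<^sub>E F" using u by (auto simp: f_def)
    then have "finite (f ` S)" using finite_PiE[of "{-int N..int N}" "\<lambda>_. F"] F finite_subset by blast
    from pigeonhole_infinite[OF S this] obtain k0 where
      inf: "infinite {k\<in>S. f k = f k0}" by blast
    have "agree_upto (int N) (u k) (u l)" if "f k = f l" for k l
      unfolding agree_upto_def
    proof (intro allI impI)
      fix t assume "\<bar>t\<bar> \<le> int N"
      then show "u k t = u l t" using fun_cong[OF that, of t] by (simp add: f_def abs_le_iff)
    qed
    with inf have "P N {k\<in>S. f k = f k0}" by (auto simp: P_def)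
    then show ?thesis by blast
  qed
  have "\<exists>S. \<forall>N. P N (S N) \<and> S (Suc N) \<subseteq> S N"
  proof (rule dependent_nat_choice)
    show "\<exists>S. P 0 S" using step[of UNIV 0] by auto
  next
    fix S n assume "P n S"
    then show "\<exists>S'. P (Suc n) S' \<and> S' \<subseteq> S" using step[of S "Suc n"] by (auto simp: P_def)
  qed
  then obtain S where S: "\<And>N. P N (S N)" and dec: "\<And>N. S (Suc N) \<subseteq> S N" by blast
  have mono: "S N \<subseteq> S M" if "M \<le> N" for M N
    using dec that by (rule lift_Suc_antimono_le)
  define x where "x = (\<lambda>t. u (SOME k. k \<in> S (nat \<bar>t\<bar>)) t)"
  have "\<exists>k\<ge>N. agree_upto (int N) x (u k)" for N
  proof -
    from S[of N] obtain k where k: "k \<ge> N" "k \<in> S N"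
      unfolding P_def by (meson infinite_nat_iff_unbounded_le)
    have "x t = u k t" if t: "\<bar>t\<bar> \<le> int N" for t
    proof -
      have kt: "k \<in> S (nat \<bar>t\<bar>)" using mono[of "nat \<bar>t\<bar>" N] k t by (auto simp: nat_le_iff)
      define l where "l = (SOME k. k \<in> S (nat \<bar>t\<bar>))"
      have "l \<in> S (nat \<bar>t\<bar>)" unfolding l_def using kt by (rule someI)
      then have "agree_upto (int (nat \<bar>t\<bar>)) (u l) (u k)" using S kt unfolding P_def by blast
      then show ?thesis unfolding x_def l_def[symmetric] by (rule agree_uptoD) simp
    qed
    then have "agree_upto (int N) x (u k)" by (simp add: agree_upto_def)
    with k(1) show ?thesis by blast
  qed
  then show ?thesis by blast
qed

lemma closedin_full_shift_limit_point:
  fixes u :: "nat \<Rightarrow> int \<Rightarrow> 'b::finite"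
  assumes "closedin full_shift_topology X" and u: "\<And>k. u k \<in> X"
  shows "\<exists>x\<in>X. \<forall>N. \<exists>k\<ge>N. agree_upto (int N) x (u k)"
proof -
  obtain x where x: "\<And>N. \<exists>k\<ge>N. agree_upto (int N) x (u k)"
    using full_shift_limit_point[of UNIV u] by auto
  have "\<exists>y\<in>X. agree_upto N x y" for N
  proof -
    obtain k where "agree_upto (int (nat N)) x (u k)" using x by blast
    then have "agree_upto N x (u k)" by (rule agree_upto_mono) simp
    with u show ?thesis by blast
  qed
  with assms(1) have "x \<in> X" unfolding closedin_full_shift_iff by blast
  with x show ?thesis by blast
qed

section \<open>Number of words of an infinite subshift\<close>

text \<open>The Morse--Hedlund argument. If passing from length \<open>L\<close> to \<open>L + 1\<close> creates no new words,
  then a word of length \<open>L\<close> has only one extension to the right and, by shift invariance, only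
  one to the left. A window of length \<open>L\<close> then determines the whole point, and \<open>X\<close> is finite. So
  the number of words strictly increases with their length.\<close>

lemma card_windows_gt:
  fixes X :: "(int \<Rightarrow> 'b::finite) set"
  assumes inf: "infinite X"
    and shift: "\<And>x s. x \<in> X \<Longrightarrow> (\<lambda>t. x (t + s)) \<in> X"
  shows "L < card ((\<lambda>x. restrict x {0..<int L}) ` X)"
proof -
  have fin: "finite ((\<lambda>x. restrict x {0..<int L}) ` X)" for L
    by (rule finite_subset[OF _ finite_PiE[of "{0..<int L}" "\<lambda>_. UNIV"]]) auto
  show ?thesis
  proof (induction L)
    case 0
    from inf have "X \<noteq> {}" by auto
    then show ?case using fin[of 0] by (metis card_gt_0_iff image_is_empty)
  next
    case (Suc L)
    let ?W = "\<lambda>L. (\<lambda>x. restrict x {0..<int L}) ` X"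
    have "card (?W L) < card (?W (Suc L))"
    proof (rule ccontr)
      assume "\<not> ?thesis"
      then have le: "card (?W (Suc L)) \<le> card (?W L)" by simp
      have inj: "inj_on g (?W (Suc L))" if "g ` ?W (Suc L) = ?W L" for g
      proof -
        have "card (?W L) \<le> card (?W (Suc L))" using card_image_le[OF fin[of "Suc L"], of g] that by simp
        with le that show ?thesis by (intro eq_card_imp_inj_on fin) simp
      qed
      \<comment> \<open>remove the last, respectively the first, letter of a word of length \<open>L + 1\<close>\<close>
      define g where "g = (\<lambda>f :: int \<Rightarrow> 'b. restrict f {0..<int L})"
      define h where "h = (\<lambda>f :: int \<Rightarrow> 'b. restrict (\<lambda>t. f (t + 1)) {0..<int L})"
      have g: "g (restrict x {0..<int (Suc L)}) = restrict x {0..<int L}" for x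
        by (auto simp: g_def restrict_def)
      have h: "h (restrict x {0..<int (Suc L)}) = restrict (\<lambda>t. x (t + 1)) {0..<int L}" for x
        by (auto simp: h_def restrict_def)
      have "g ` ?W (Suc L) = ?W L" by (simp only: image_image g)
      then have injg: "inj_on g (?W (Suc L))" by (rule inj)
      have "h ` ?W (Suc L) = ?W L"
      proof -
        have "restrict x {0..<int L} \<in> h ` ?W (Suc L)" if "x \<in> X" for x
        proof -
          have "restrict x {0..<int L} = h (restrict (\<lambda>t. x (t + -1)) {0..<int (Suc L)})"
            unfolding h by simp
          with shift[OF that, of "-1"] show ?thesis by blast
        qed
        moreover have "h (restrict x {0..<int (Suc L)}) \<in> ?W L" if "x \<in> X" for x
          unfolding h using shift[OF that, of 1] by blast
        ultimately show ?thesis by blast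
      qed
      then have injh: "inj_on h (?W (Suc L))" by (rule inj)
      have ext: "x (s - 1) = y (s - 1) \<and> x (s + int L) = y (s + int L)"
        if xy: "x \<in> X" "y \<in> X" and eq: "\<And>t. s \<le> t \<Longrightarrow> t < s + int L \<Longrightarrow> x t = y t" for x y s
      proof
        have 1: "(\<lambda>t. x (t + (s - 1))) \<in> X" "(\<lambda>t. y (t + (s - 1))) \<in> X"
          using xy shift by blast+
        have "h (restrict (\<lambda>t. x (t + (s - 1))) {0..<int (Suc L)}) =
              h (restrict (\<lambda>t. y (t + (s - 1))) {0..<int (Suc L)})"
          unfolding h by (rule restrict_ext) (auto intro!: eq)
        then have "restrict (\<lambda>t. x (t + (s - 1))) {0..<int (Suc L)} =
              restrict (\<lambda>t. y (t + (s - 1))) {0..<int (Suc L)}"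
          by (rule inj_onD[OF injh _ imageI[OF 1(1)] imageI[OF 1(2)]])
        from fun_cong[OF this, of 0] show "x (s - 1) = y (s - 1)" by simp
        have 2: "(\<lambda>t. x (t + s)) \<in> X" "(\<lambda>t. y (t + s)) \<in> X"
          using xy shift by blast+
        have "g (restrict (\<lambda>t. x (t + s)) {0..<int (Suc L)}) =
              g (restrict (\<lambda>t. y (t + s)) {0..<int (Suc L)})"
          unfolding g by (rule restrict_ext) (auto intro!: eq)
        then have "restrict (\<lambda>t. x (t + s)) {0..<int (Suc L)} =
              restrict (\<lambda>t. y (t + s)) {0..<int (Suc L)}"
          by (rule inj_onD[OF injg _ imageI[OF 2(1)] imageI[OF 2(2)]])
        from fun_cong[OF this, of "int L"] show "x (s + int L) = y (s + int L)"
          by (simp add: add.commute)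
      qed
      have "inj_on (\<lambda>x. restrict x {0..<int L}) X"
      proof (rule inj_onI)
        fix x y assume xy: "x \<in> X" "y \<in> X" and eq: "restrict x {0..<int L} = restrict y {0..<int L}"
        have all: "\<forall>t. - int n \<le> t \<longrightarrow> t < int L + int n \<longrightarrow> x t = y t" for n
        proof (induction n)
          case 0
          have "x t = y t" if "0 \<le> t" "t < int L" for t
            using fun_cong[OF eq, of t] that by simp
          then show ?case by simp
        next
          case (Suc n)
          then have e: "x t = y t" if "- int n \<le> t" "t < int L + int n" for t using that by blast
          have "x (- int n - 1) = y (- int n - 1)"
            using ext[OF xy, of "- int n"] e by force
          moreover have "x (int n + int L) = y (int n + int L)"
            using ext[OF xy, of "int n"] e by force
          ultimately have "x t = y t" if "- int (Suc n) \<le> t" "t < int L + int (Suc n)" for t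
            using that e[of t] by (cases "t = - int n - 1 \<or> t = int n + int L") auto
          then show ?case by blast
        qed
        have "x t = y t" for t using all[of "Suc (nat \<bar>t\<bar>)"] by (simp add: abs_less_iff)
        then show "x = y" by blast
      qed
      with fin[of L] inf show False using finite_imageD by blast
    qed
    with Suc show ?case by linarith
  qed
qed

section \<open>Li--Yorke pairs in terms of coordinates\<close>

lemma funpow_shift: "(shift ^^ n) x = (\<lambda>t. x (t + int n))"
  by (induction n) (auto simp: shift_def algebra_simps)

lemma subshift_shift_invariant:
  assumes "subshift Y" "y \<in> Y"
  shows "(\<lambda>t. y (t + s)) \<in> Y"
proof -
  have im: "shift ` Y = Y" using assms(1) by (simp add: subshift_def)
  have fwd: "\<forall>y\<in>Y. (\<lambda>t. y (t + int n)) \<in> Y" for n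
  proof (induction n)
    case (Suc n)
    have "shift y \<in> Y" if "y \<in> Y" for y using im that by blast
    with Suc show ?case by (force simp: shift_def algebra_simps)
  qed simp
  have bwd: "\<forall>y\<in>Y. (\<lambda>t. y (t - int n)) \<in> Y" for n
  proof (induction n)
    case (Suc n)
    show ?case
    proof
      fix y assume "y \<in> Y"
      then obtain z where z: "z \<in> Y" "y = shift z" using im by blast
      with Suc have "(\<lambda>t. z (t - int n)) \<in> Y" by blast
      then show "(\<lambda>t. y (t - int (Suc n))) \<in> Y" using z by (simp add: shift_def algebra_simps)
    qed
  qed simp
  from assms(2) fwd[of "nat s"] bwd[of "nat (- s)"] show ?thesis
    by (cases "0 \<le> s") auto
qed

lemma compatible_metric_small_ball:
  assumes "compatible_metric X \<rho>" "u \<in> X" "0 < e"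
  shows "\<exists>N. \<forall>v\<in>X. agree_upto N u v \<longrightarrow> \<rho> u v < e"
proof -
  from assms(1) interpret Metric_space X \<rho> by (simp add: compatible_metric_def)
  have top: "mtopology = subtopology full_shift_topology X"
    using assms(1) by (simp add: compatible_metric_def)
  have "openin (subtopology full_shift_topology X) (mball u e)" 
    using openin_mball top by metis
  then obtain T where T: "openin full_shift_topology T" "mball u e = T \<inter> X"
    unfolding openin_subtopology by blast
  have "u \<in> T" using T(2) assms by (metis IntD1 centre_in_mball_iff)
  then obtain N where N: "\<And>v. agree_upto N u v \<Longrightarrow> v \<in> T"
    using T(1) unfolding openin_full_shift_iff by blast
  have "\<rho> u v < e" if "v \<in> X" "agree_upto N u v" for v
    using N[OF that(2)] that(1) T(2) by (metis IntI in_mball)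
  then show ?thesis by blast
qed

lemma compatible_metric_small_distance:
  assumes "compatible_metric X \<rho>" "u \<in> X"
  shows "\<exists>e>0. \<forall>v\<in>X. \<rho> u v < e \<longrightarrow> agree_upto N u v"
proof -
  from assms(1) interpret Metric_space X \<rho> by (simp add: compatible_metric_def)
  have top: "mtopology = subtopology full_shift_topology X"
    using assms(1) by (simp add: compatible_metric_def)
  have "openin full_shift_topology {v. agree_upto N u v}"
    unfolding openin_full_shift_iff using agree_upto_trans by blast
  then have "openin mtopology ({v. agree_upto N u v} \<inter> X)"
    unfolding top openin_subtopology by blast
  moreover have "u \<in> {v. agree_upto N u v} \<inter> X" using assms(2) by (simp add: agree_upto_def)
  ultimately obtain e where e: "0 < e" "mball u e \<subseteq> {v. agree_upto N u v} \<inter> X"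
    unfolding openin_mtopology by blast
  have "agree_upto N u v" if "v \<in> X" "\<rho> u v < e" for v
    using e(2) that assms(2) in_mball by blast
  with e(1) show ?thesis by blast
qed

text \<open>Otherwise there are pairs which agree on larger and larger windows but stay \<open>e\<close> apart.
  Both components approach a common limit point, at which the metric is small on some window.\<close>

lemma uniformly_small_distance:
  fixes X :: "(int \<Rightarrow> 'b::finite) set"
  assumes X: "closedin full_shift_topology X" and \<rho>: "compatible_metric X \<rho>" and e: "0 < e"
  shows "\<exists>N. \<forall>u\<in>X. \<forall>v\<in>X. agree_upto N u v \<longrightarrow> \<rho> u v < e"
proof (rule ccontr)
  from \<rho> interpret Metric_space X \<rho> by (simp add: compatible_metric_def)
  assume "\<not> ?thesis"
  then have "\<forall>k::nat. \<exists>u v. u \<in> X \<and> v \<in> X \<and> agree_upto (int k) u v \<and> e \<le> \<rho> u v"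
    by (metis linorder_not_less)
  then obtain u v where uv: "\<And>k. u k \<in> X" "\<And>k. v k \<in> X"
    "\<And>k::nat. agree_upto (int k) (u k) (v k)" "\<And>k. e \<le> \<rho> (u k) (v k)" by metis
  obtain x where x: "x \<in> X" "\<And>N. \<exists>k\<ge>N. agree_upto (int N) x (u k)"
    using closedin_full_shift_limit_point[of X u] X uv(1) by blast
  obtain N where N: "\<And>w. w \<in> X \<Longrightarrow> agree_upto N x w \<Longrightarrow> \<rho> x w < e / 2"
    using compatible_metric_small_ball[OF \<rho> x(1), of "e / 2"] e by auto
  obtain k where k: "k \<ge> nat N" "agree_upto (int (nat N)) x (u k)" using x(2) by blast
  have 1: "agree_upto N x (u k)" using k(2) by (rule agree_upto_mono) simp
  have "agree_upto N (u k) (v k)" using uv(3)[of k] by (rule agree_upto_mono) (use k(1) in linarith)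
  with 1 have "agree_upto N x (v k)" by (rule agree_upto_trans)
  then have "\<rho> x (u k) < e / 2" "\<rho> x (v k) < e / 2" using N 1 uv by blast+
  with triangle[of "u k" x "v k"] commute[of "u k" x] uv(1,2,4)[of k] x(1) show False by simp
qed

text \<open>Otherwise there are pairs at distance tending to \<open>0\<close> that disagree up to \<open>N\<close>. Both
  components approach a common limit point, and all points near it agree with it up to \<open>N\<close>.\<close>

lemma uniformly_agree:
  fixes X :: "(int \<Rightarrow> 'b::finite) set"
  assumes X: "closedin full_shift_topology X" and \<rho>: "compatible_metric X \<rho>"
  shows "\<exists>e>0. \<forall>u\<in>X. \<forall>v\<in>X. \<rho> u v < e \<longrightarrow> agree_upto N u v"
proof (rule ccontr)
  from \<rho> interpret Metric_space X \<rho> by (simp add: compatible_metric_def)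
  assume *: "\<not> ?thesis"
  have "\<forall>k::nat. \<exists>u v. u \<in> X \<and> v \<in> X \<and> \<rho> u v < 1 / real (Suc k) \<and> \<not> agree_upto N u v"
  proof
    fix k :: nat
    have "0 < 1 / real (Suc k)" by simp
    with * show "\<exists>u v. u \<in> X \<and> v \<in> X \<and> \<rho> u v < 1 / real (Suc k) \<and> \<not> agree_upto N u v" by blast
  qed
  then obtain u v where uv: "\<And>k. u k \<in> X" "\<And>k. v k \<in> X"
    "\<And>k. \<rho> (u k) (v k) < 1 / real (Suc k)" "\<And>k. \<not> agree_upto N (u k) (v k)" by metis
  obtain x where x: "x \<in> X" "\<And>N. \<exists>k\<ge>N. agree_upto (int N) x (u k)"
    using closedin_full_shift_limit_point[of X u] X uv(1) by blast
  obtain e where e: "0 < e" "\<And>w. w \<in> X \<Longrightarrow> \<rho> x w < e \<Longrightarrow> agree_upto N x w"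
    using compatible_metric_small_distance[OF \<rho> x(1)] by blast
  obtain M where M: "\<And>w. w \<in> X \<Longrightarrow> agree_upto M x w \<Longrightarrow> \<rho> x w < e / 2"
    using compatible_metric_small_ball[OF \<rho> x(1), of "e / 2"] e by auto
  obtain l where l: "1 / real (Suc l) < e / 2"
    using e(1) reals_Archimedean[of "e / 2"] by (auto simp: inverse_eq_divide)
  obtain k where k: "k \<ge> nat M + l" "agree_upto (int (nat M + l)) x (u k)" using x(2) by blast
  have "agree_upto M x (u k)" using k(2) by (rule agree_upto_mono) simp
  then have d: "\<rho> x (u k) < e / 2" using M uv(1) by blast
  have "1 / real (Suc k) \<le> 1 / real (Suc l)" using k(1) by (simp add: frac_le)
  with l uv(3)[of k] have "\<rho> (u k) (v k) < e / 2" by linarith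
  with d triangle[of x "u k" "v k"] uv(1,2)[of k] x(1) have "\<rho> x (v k) < e" by simp
  then have "agree_upto N x (v k)" "agree_upto N x (u k)" using e uv(1,2) d by auto
  with uv(4)[of k] show False using agree_upto_sym agree_upto_trans by blast
qed

text \<open>The coordinate form of a Li--Yorke pair. Agreement is asked for on windows \<open>{n..n + L}\<close> to
  the right of \<open>n\<close>, not around \<open>n\<close>; this is equivalent, as \<open>n\<close> and \<open>L\<close> are arbitrarily large,
  and simpler to carry through blocks.\<close>

definition forward_Li_Yorke :: "(int \<Rightarrow> 'b) \<Rightarrow> (int \<Rightarrow> 'b) \<Rightarrow> bool" where
  "forward_Li_Yorke x y \<longleftrightarrow> (\<forall>N. \<exists>n\<ge>N. x n \<noteq> y n) \<and>
     (\<forall>L. \<exists>n\<ge>L. \<forall>t. n \<le> t \<and> t \<le> n + L \<longrightarrow> x t = y t)"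

lemma Li_Yorke_pair_iff:
  fixes X :: "(int \<Rightarrow> 'b::finite) set"
  assumes X: "subshift X" and \<rho>: "compatible_metric X \<rho>" and xy: "x \<in> X" "y \<in> X"
  shows "Li_Yorke_pair \<rho> x y \<longleftrightarrow> forward_Li_Yorke x y"
proof -
  from \<rho> interpret Metric_space X \<rho> by (simp add: compatible_metric_def)
  have closed: "closedin full_shift_topology X" using X by (simp add: subshift_def)
  define T where "T = (\<lambda>z :: int \<Rightarrow> 'b. \<lambda>n :: nat. \<lambda>t. z (t + int n))"
  define d where "d = (\<lambda>n. \<rho> (T x n) (T y n))"
  have TX: "T x n \<in> X" "T y n \<in> X" for n
    using subshift_shift_invariant[OF X] xy by (auto simp: T_def)
  have d_nonneg: "0 \<le> d n" for n by (simp add: d_def)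
  have LY: "Li_Yorke_pair \<rho> x y \<longleftrightarrow> limsup (\<lambda>n. ereal (d n)) > 0 \<and> liminf (\<lambda>n. ereal (d n)) = 0"
    unfolding Li_Yorke_pair_def d_def T_def funpow_shift ..
  have limsup: "limsup (\<lambda>n. ereal (d n)) > 0 \<longleftrightarrow> (\<forall>N. \<exists>n\<ge>N. x n \<noteq> y n)"
  proof
    assume pos: "limsup (\<lambda>n. ereal (d n)) > 0"
    show "\<forall>N. \<exists>n\<ge>N. x n \<noteq> y n"
    proof (rule ccontr)
      assume "\<not> ?thesis"
      then obtain N where N: "\<And>n. n \<ge> N \<Longrightarrow> x n = y n" by blast
      obtain c where c: "0 < ereal c" "ereal c < limsup (\<lambda>n. ereal (d n))"
        using ereal_dense2[OF pos] by blast
      obtain L where L: "\<And>u v. u \<in> X \<Longrightarrow> v \<in> X \<Longrightarrow> agree_upto L u v \<Longrightarrow> \<rho> u v < c"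
        using uniformly_small_distance[OF closed \<rho>, of c] c(1) by auto
      have "d n \<le> c" if "n \<ge> nat (N + L)" for n
      proof -
        have "agree_upto L (T x n) (T y n)"
          unfolding agree_upto_def T_def using that by (auto intro!: N)
        from L[OF TX this] show ?thesis by (simp add: d_def)
      qed
      then have "eventually (\<lambda>n. ereal (d n) \<le> ereal c) sequentially"
        unfolding eventually_sequentially by auto
      then have "limsup (\<lambda>n. ereal (d n)) \<le> ereal c" by (rule Limsup_bounded)
      with c(2) show False by simp
    qed
  next
    assume inf: "\<forall>N. \<exists>n\<ge>N. x n \<noteq> y n"
    obtain e where e: "0 < e" "\<And>u v. u \<in> X \<Longrightarrow> v \<in> X \<Longrightarrow> \<rho> u v < e \<Longrightarrow> agree_upto 0 u v"
      using uniformly_agree[OF closed \<rho>, of 0] by blast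
    have "ereal e \<le> limsup (\<lambda>n. ereal (d n))"
    proof (rule ccontr)
      assume "\<not> ?thesis"
      then have "limsup (\<lambda>n. ereal (d n)) < ereal e" by simp
      then have "eventually (\<lambda>n. ereal (d n) < ereal e) sequentially"
        by (rule Limsup_lessD)
      then obtain N where N: "\<And>n. n \<ge> N \<Longrightarrow> d n < e" unfolding eventually_sequentially by auto
      from inf obtain n where n: "n \<ge> int N" "x n \<noteq> y n" by blast
      have "agree_upto 0 (T x (nat n)) (T y (nat n))"
        using N[of "nat n"] n(1) by (intro e(2) TX) (simp add: d_def nat_le_iff le_nat_iff)
      from agree_uptoD[OF this, of 0] n show False by (simp add: T_def)
    qed
    with e(1) show "limsup (\<lambda>n. ereal (d n)) > 0"
      by (metis ereal_less(2) less_le_trans)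
  qed
  have liminf: "liminf (\<lambda>n. ereal (d n)) = 0 \<longleftrightarrow>
      (\<forall>L. \<exists>n\<ge>L. \<forall>t. n \<le> t \<and> t \<le> n + L \<longrightarrow> x t = y t)"
  proof
    assume zero: "liminf (\<lambda>n. ereal (d n)) = 0"
    show "\<forall>L. \<exists>n\<ge>L. \<forall>t. n \<le> t \<and> t \<le> n + L \<longrightarrow> x t = y t"
    proof
      fix L :: int
      obtain e where e: "0 < e" "\<And>u v. u \<in> X \<Longrightarrow> v \<in> X \<Longrightarrow> \<rho> u v < e \<Longrightarrow> agree_upto L u v"
        using uniformly_agree[OF closed \<rho>, of L] by blast
      have "\<not> eventually (\<lambda>n. ereal e \<le> ereal (d n)) sequentially"
      proof
        assume "eventually (\<lambda>n. ereal e \<le> ereal (d n)) sequentially"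
        then have "ereal e \<le> liminf (\<lambda>n. ereal (d n))" by (rule Liminf_bounded)
        with zero e(1) show False by (simp add: zero_ereal_def)
      qed
      then obtain n where n: "n \<ge> nat L" "d n < e"
        unfolding eventually_sequentially by (auto simp: not_le)
      have "agree_upto L (T x n) (T y n)" using n(2) by (intro e(2) TX) (simp add: d_def)
      from agree_uptoD[OF this] have "x (t + int n) = y (t + int n)" if "0 \<le> t" "t \<le> L" for t
        using that by (simp add: T_def)
      from this[of "t - int n" for t] show "\<exists>n\<ge>L. \<forall>t. n \<le> t \<and> t \<le> n + L \<longrightarrow> x t = y t"
        using n(1) by (intro exI[of _ "int n"]) auto
    qed
  next
    assume agr: "\<forall>L. \<exists>n\<ge>L. \<forall>t. n \<le> t \<and> t \<le> n + L \<longrightarrow> x t = y t"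
    have "liminf (\<lambda>n. ereal (d n)) \<le> 0"
    proof (rule ccontr)
      assume "\<not> ?thesis"
      then have "0 < liminf (\<lambda>n. ereal (d n))" by simp
      from ereal_dense2[OF this] obtain e where "0 < ereal e"
        and lim: "ereal e < liminf (\<lambda>n. ereal (d n))" by blast
      then have e: "0 < e" by simp
      from lim have "eventually (\<lambda>n. ereal e < ereal (d n)) sequentially"
        by (rule less_LiminfD)
      then obtain N where N: "\<And>n. n \<ge> N \<Longrightarrow> e < d n" unfolding eventually_sequentially by auto
      obtain L where L: "\<And>u v. u \<in> X \<Longrightarrow> v \<in> X \<Longrightarrow> agree_upto L u v \<Longrightarrow> \<rho> u v < e"
        using uniformly_small_distance[OF closed \<rho> e] by blast
      \<comment> \<open>agreement on a window of length \<open>2 M\<close> is agreement up to \<open>M\<close> around its middle\<close>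
      define M where "M = max 0 L"
      from agr obtain n where n: "n \<ge> 2 * M + int N"
        "\<And>t. n \<le> t \<Longrightarrow> t \<le> n + (2 * M + int N) \<Longrightarrow> x t = y t" by blast
      have "agree_upto L (T x (nat (n + M))) (T y (nat (n + M)))"
        unfolding agree_upto_def T_def
      proof (intro allI impI n(2))
        fix t assume "\<bar>t\<bar> \<le> L"
        then show "n \<le> t + int (nat (n + M))" "t + int (nat (n + M)) \<le> n + (2 * M + int N)"
          using n(1) by (auto simp: M_def)
      qed
      from L[OF TX this] have "d (nat (n + M)) < e" by (simp add: d_def)
      moreover have "N \<le> nat (n + M)" using n(1) unfolding M_def by linarith
      ultimately show False using N[of "nat (n + M)"] by simp
    qed
    moreover have "0 \<le> liminf (\<lambda>n. ereal (d n))"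
      by (rule Liminf_bounded) (simp add: d_nonneg)
    ultimately show "liminf (\<lambda>n. ereal (d n)) = 0" by (rule antisym)
  qed
  show ?thesis unfolding LY limsup liminf forward_Li_Yorke_def ..
qed

section \<open>Iterates of a substitution of constant length\<close>

lemma nth_concat_equal_lengths:
  assumes "\<And>w. w \<in> set ws \<Longrightarrow> length w = q" and "k < q * length ws"
  shows "concat ws ! k = ws ! (k div q) ! (k mod q)"
  using assms
proof (induction ws arbitrary: k)
  case Nil
  then show ?case by simp
next
  case (Cons w ws)
  then have w: "length w = q" by simp
  show ?case
  proof (cases "k < q")
    case True
    with w show ?thesis by (simp add: nth_append)
  next
    case False
    with Cons.prems have "0 < q" by (cases q) auto
    have "concat ws ! (k - q) = ws ! ((k - q) div q) ! ((k - q) mod q)"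
      using Cons.prems False by (intro Cons.IH) auto
    with w False \<open>0 < q\<close> show ?thesis
      by (simp add: nth_append le_div_geq le_mod_geq not_less)
  qed
qed

lemma abs_div_le:
  fixes q :: int
  assumes "1 \<le> q"
  shows "\<bar>t div q\<bar> \<le> \<bar>t\<bar>"
proof (cases "0 \<le> t")
  case True
  with assms have "t div q \<le> t" "0 \<le> t div q"
    using zdiv_mono2[of t 1 q] by (simp_all add: pos_imp_zdiv_nonneg_iff)
  with True show ?thesis by simp
next
  case False
  with assms have "t \<le> t div q" "t div q < 0"
    using zdiv_mono2_neg[of t 1 q] by (simp_all add: pos_imp_zdiv_neg_iff)
  with False show ?thesis by simp
qed

locale uniform_substitution =
  fixes \<tau> :: "'a::finite substitution" and p :: nat
  assumes length_ge_2: "2 \<le> p"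
    and constant_length: "constant_length \<tau> p"
    and primitive: "primitive \<tau>"
    and injective: "inj \<tau>"
begin

lemma iterate_0 [simp]: "iterate \<tau> 0 a = [a]"
  by (simp add: iterate_def)

lemma iterate_1 [simp]: "iterate \<tau> 1 = \<tau>" "iterate \<tau> (Suc 0) = \<tau>"
  by (simp_all add: iterate_def extend_def fun_eq_iff)

lemma p_pos [simp]: "0 < p"
  using length_ge_2 by simp

lemma extend_power: "(extend \<tau> ^^ m) w = concat (map (iterate \<tau> m) w)"
proof (induction m)
  case 0
  show ?case by (induction w) (simp_all add: iterate_def)
next
  case (Suc m)
  have "extend \<tau> (concat vs) = concat (map (extend \<tau>) vs)" for vs
    by (induction vs) (simp_all add: extend_def)
  with Suc show ?case by (simp add: iterate_def o_def)
qed

lemma iterate_add: "iterate \<tau> (m + n) a = concat (map (iterate \<tau> m) (iterate \<tau> n a))"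
  by (simp add: iterate_def[of _ "m + n"] funpow_add extend_power[symmetric] iterate_def[of _ n])

lemma length_iterate [simp]: "length (iterate \<tau> n a) = p ^ n"
proof (induction n)
  case (Suc n)
  have "length (iterate \<tau> (1 + n) a) = p * p ^ n"
    using Suc constant_length unfolding iterate_add
    by (simp add: length_concat o_def constant_length_def sum_list_triv)
  then show ?case by simp
qed simp

lemma int_p_power_pos [simp]: "0 < int p ^ n"
  using length_ge_2 by simp

lemma n_less_p_power: "int n < int p ^ n"
proof -
  have "n < 2 ^ n" by (rule less_exp)
  also have "\<dots> \<le> p ^ n" using length_ge_2 by (rule power_mono) simp
  finally show ?thesis by (metis of_nat_less_iff of_nat_power)
qed

text \<open>The letter at place \<open>t\<close> of \<open>\<tau>\<^bsup>m + n\<^esup>(a)\<close> lies below the letter of \<open>\<tau>\<^sup>n(a)\<close> whose index is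
  the quotient of \<open>t\<close>, at the place given by the remainder. Places are integers, to match
  coordinates of points.\<close>

lemma iterate_add_nth:
  assumes "0 \<le> t" "t < int p ^ (m + n)"
  shows "iterate \<tau> (m + n) a ! nat t =
    iterate \<tau> m (iterate \<tau> n a ! nat (t div int p ^ m)) ! nat (t mod int p ^ m)"
proof -
  obtain k where k: "t = int k" using assms(1) nonneg_int_cases by blast
  with assms have "k < p ^ (m + n)" by (metis of_nat_less_iff of_nat_power)
  then have k1: "k < p ^ m * p ^ n" by (simp add: power_add)
  then have "k div p ^ m < p ^ n" by (simp add: less_mult_imp_div_less mult.commute)
  with k1 have "iterate \<tau> (m + n) a ! k = iterate \<tau> m (iterate \<tau> n a ! (k div p ^ m)) ! (k mod p ^ m)"
    unfolding iterate_add by (subst nth_concat_equal_lengths[where q = "p ^ m"]) auto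
  then show ?thesis unfolding k by (metis nat_int of_nat_power zdiv_int zmod_int)
qed

lemma inj_iterate: "inj (iterate \<tau> n)"
proof (induction n)
  case 0
  show ?case by (rule injI) simp
next
  case (Suc n)
  have ext: "concat (map \<tau> v) = concat (map \<tau> w) \<Longrightarrow> v = w" if "length v = length w" for v w
    using that
  proof (induction v w rule: list_induct2)
    case (Cons x xs y ys)
    then have "\<tau> x = \<tau> y \<and> concat (map \<tau> xs) = concat (map \<tau> ys)"
      using constant_length by (auto simp: constant_length_def)
    with Cons injective show ?case by (auto dest: injD)
  qed simp
  have "iterate \<tau> (Suc n) a = iterate \<tau> (Suc n) b \<Longrightarrow> iterate \<tau> n a = iterate \<tau> n b" for a b
    using ext[of "iterate \<tau> n a" "iterate \<tau> n b"] iterate_add[of 1 n] by simp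
  with Suc show ?case unfolding inj_def by metis
qed

text \<open>This is \<open>T\<^sup>i \<tau>\<^sup>n(x)\<close>: coordinate \<open>t\<close> lies in the block that comes from coordinate
  \<open>(t + i) div p\<^sup>n\<close> of \<open>x\<close>. With \<open>n = 0\<close> it is a plain power of the shift, so that shifts and
  iterates compose by the one rule \<open>inflate_inflate\<close>.\<close>

definition inflate :: "nat \<Rightarrow> int \<Rightarrow> (int \<Rightarrow> 'a) \<Rightarrow> int \<Rightarrow> 'a" where
  "inflate n i x = (\<lambda>t. iterate \<tau> n (x ((t + i) div int p ^ n)) ! nat ((t + i) mod int p ^ n))"

lemma inflate_0 [simp]: "inflate 0 i x = (\<lambda>t. x (t + i))"
  by (simp add: inflate_def)

lemma inflate_inflate: "inflate m i (inflate n k x) = inflate (m + n) (i + int p ^ m * k) x"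
proof
  fix t
  define P Q where "P = int p ^ m" and "Q = int p ^ n"
  have pos: "0 < P" "0 < Q" by (simp_all add: P_def Q_def)
  define J where "J = t + (i + P * k)"
  have J: "J div P = (t + i) div P + k" "J mod P = (t + i) mod P"
    using pos by (simp_all add: J_def add.assoc[symmetric])
  have PQ: "int p ^ (m + n) = P * Q" by (simp add: P_def Q_def power_add)
  have dm: "J mod (P * Q) = P * (J div P mod Q) + J mod P" "J div (P * Q) = J div P div Q"
    using pos by (simp_all add: zmod_zmult2_eq zdiv_zmult2_eq)
  have "inflate (m + n) (i + int p ^ m * k) x t
      = iterate \<tau> (m + n) (x (J div (P * Q))) ! nat (J mod (P * Q))"
    unfolding inflate_def PQ by (simp add: J_def P_def)
  also have "\<dots> = iterate \<tau> m (iterate \<tau> n (x (J div (P * Q))) ! nat (J mod (P * Q) div P)) ! nat (J mod (P * Q) mod P)"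
    unfolding P_def Q_def by (rule iterate_add_nth[folded power_add]) (simp_all add: power_add[symmetric])
  also have "J mod (P * Q) mod P = J mod P" unfolding dm(1) using pos by simp
  also have "J mod (P * Q) div P = J div P mod Q" unfolding dm(1) using pos by simp
  finally show "inflate m i (inflate n k x) t = inflate (m + n) (i + int p ^ m * k) x t"
    unfolding dm(2) J by (simp add: inflate_def P_def Q_def)
qed

lemma inflate_shift: "inflate n i x (t + s) = inflate n (i + s) x t"
  by (simp add: inflate_def algebra_simps)

lemma inflate_normalize:
  "inflate n i x = inflate n (i mod int p ^ n) (\<lambda>t. x (t + i div int p ^ n))"
  using inflate_inflate[of n "i mod int p ^ n" 0 "i div int p ^ n" x] by simp

lemma inflate_letter:
  assumes "0 \<le> t + i" "t + i < int p ^ n"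
  shows "inflate n i x t = iterate \<tau> n (x 0) ! nat (t + i)"
  using assms by (simp add: inflate_def)

text \<open>A letter can be read off from its block, because \<open>\<tau>\<^sup>n\<close> is injective on letters.\<close>

lemma inflate_eq_block:
  assumes "\<And>t. (t + i) div int p ^ n = s \<Longrightarrow> inflate n i x t = inflate n i y t"
  shows "x s = y s"
proof -
  have "iterate \<tau> n (x s) ! k = iterate \<tau> n (y s) ! k" if k: "k < p ^ n" for k
  proof -
    define t where "t = int p ^ n * s + int k - i"
    have k': "int k < int p ^ n" using k by (metis of_nat_less_iff of_nat_power)
    have "t + i = int k + int p ^ n * s" by (simp add: t_def)
    with k' have "(t + i) div int p ^ n = s" "(t + i) mod int p ^ n = int k"
      by (simp_all only: div_mult_self2 mod_mult_self2 div_pos_pos_trivial mod_pos_pos_trivial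
          int_p_power_pos[THEN less_imp_neq, symmetric] of_nat_0_le_iff not_False_eq_True)
    with assms[of t] show ?thesis by (simp add: inflate_def)
  qed
  then have "iterate \<tau> n (x s) = iterate \<tau> n (y s)" by (intro nth_equalityI) simp_all
  then show ?thesis using inj_iterate by (auto dest: injD)
qed

lemma inflate_cong:
  "x ((t + i) div int p ^ n) = y ((t + i) div int p ^ n) \<Longrightarrow> inflate n i x t = inflate n i y t"
  by (simp add: inflate_def)

section \<open>The subshift of the substitution\<close>

text \<open>The points all of whose windows occur in some \<open>\<tau>\<^sup>n(a)\<close>. Only symmetric windows are tested,
  and the occurrence is given by a shift \<open>i\<close>, so that membership can be combined with \<open>inflate\<close>
  without indices of words.\<close>

definition points :: "(int \<Rightarrow> 'a) set" where
  "points = {x. \<forall>N. \<exists>n a i. \<forall>t. \<bar>t\<bar> \<le> N \<longrightarrow>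
     0 \<le> t + i \<and> t + i < int p ^ n \<and> x t = iterate \<tau> n a ! nat (t + i)}"

lemma points_closed:
  assumes "\<And>N::int. \<exists>y\<in>points. agree_upto N x y"
  shows "x \<in> points"
  unfolding points_def
proof (intro CollectI allI)
  fix N
  obtain y where y: "y \<in> points" "agree_upto N x y" using assms by blast
  from y(1) obtain n a i where "\<And>t. \<bar>t\<bar> \<le> N \<Longrightarrow>
      0 \<le> t + i \<and> t + i < int p ^ n \<and> y t = iterate \<tau> n a ! nat (t + i)"
    unfolding points_def by blast
  with agree_uptoD[OF y(2)] have "\<forall>t. \<bar>t\<bar> \<le> N \<longrightarrow>
      0 \<le> t + i \<and> t + i < int p ^ n \<and> x t = iterate \<tau> n a ! nat (t + i)" by simp
  then show "\<exists>n a i. \<forall>t. \<bar>t\<bar> \<le> N \<longrightarrow> 0 \<le> t + i \<and> t + i < int p ^ n \<and> x t = iterate \<tau> n a ! nat (t + i)"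
    by blast
qed

lemma inflate_points:
  assumes x: "x \<in> points"
  shows "inflate n i x \<in> points"
  unfolding points_def
proof (intro CollectI allI)
  fix N
  define q where "q = int p ^ n"
  have q: "0 < q" "1 \<le> q" by (simp_all add: q_def int_one_le_iff_zero_less)
  from x obtain m a k where w: "\<And>t. \<bar>t\<bar> \<le> N + \<bar>i\<bar> \<Longrightarrow>
     0 \<le> t + k \<and> t + k < int p ^ m \<and> x t = iterate \<tau> m a ! nat (t + k)"
    unfolding points_def by blast
  have "0 \<le> t + (i + q * k) \<and> t + (i + q * k) < int p ^ (n + m) \<and>
      inflate n i x t = iterate \<tau> (n + m) a ! nat (t + (i + q * k))" if t: "\<bar>t\<bar> \<le> N" for t
  proof -
    define s where "s = (t + i) div q"
    have "\<bar>s\<bar> \<le> \<bar>t + i\<bar>" unfolding s_def using q by (intro abs_div_le)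
    then have ws: "0 \<le> s + k" "s + k < int p ^ m" "x s = iterate \<tau> m a ! nat (s + k)"
      using w[of s] t by auto
    have e: "t + (i + q * k) = q * (s + k) + (t + i) mod q"
      unfolding s_def by (simp add: algebra_simps)
    have r: "0 \<le> (t + i) mod q" "(t + i) mod q < q" using q by simp_all
    have lo: "0 \<le> t + (i + q * k)" unfolding e using ws r q by simp
    have "q * (s + k) + (t + i) mod q < q * (s + k) + q" using r by simp
    also have "\<dots> = q * (s + k + 1)" by (simp add: algebra_simps)
    also have "\<dots> \<le> q * int p ^ m" using ws q by (intro mult_left_mono) auto
    finally have hi: "t + (i + q * k) < int p ^ (n + m)" unfolding e by (simp add: power_add q_def)
    have "(t + (i + q * k)) div q = s + k" "(t + (i + q * k)) mod q = (t + i) mod q"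
      using q by (simp_all add: s_def add.assoc[symmetric])
    with lo hi iterate_add_nth[OF lo hi] ws show ?thesis
      by (simp add: inflate_def q_def s_def)
  qed
  then show "\<exists>n' a k. \<forall>t. \<bar>t\<bar> \<le> N \<longrightarrow>
     0 \<le> t + k \<and> t + k < int p ^ n' \<and> inflate n i x t = iterate \<tau> n' a ! nat (t + k)" by blast
qed

lemma shift_points: "x \<in> points \<Longrightarrow> (\<lambda>t. x (t + s)) \<in> points"
  using inflate_points[of x 0 s] by simp

lemma letter_occurs: "\<exists>n. \<forall>a b. \<exists>i. 0 \<le> i \<and> i < int p ^ n \<and> a = iterate \<tau> n b ! nat i"
proof -
  from primitive obtain n where n: "\<And>a b. a \<in> set (iterate \<tau> n b)"
    unfolding primitive_def by blast
  have "\<exists>i. 0 \<le> i \<and> i < int p ^ n \<and> a = iterate \<tau> n b ! nat i" for a b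
  proof -
    obtain k where k: "k < p ^ n" "iterate \<tau> n b ! k = a"
      using n[of a b] unfolding in_set_conv_nth by auto
    then have "int k < int p ^ n" by (metis of_nat_less_iff of_nat_power)
    with k show ?thesis by (intro exI[of _ "int k"]) simp
  qed
  then show ?thesis by blast
qed

text \<open>The exponent depends on the window but not on \<open>w\<close>: the window occurs in some \<open>\<tau>\<^sup>m(a)\<close>, and
  by primitivity \<open>a\<close> occurs in \<open>\<tau>\<^sup>M(w 0)\<close> for one \<open>M\<close> that suits all letters. Both
  desubstitution and minimality rest on this.\<close>

lemma window_in_inflation:
  assumes x: "x \<in> points"
  shows "\<exists>n\<ge>1. \<forall>w. \<exists>i. agree_upto N x (inflate n i w)"
proof -
  define N' where "N' = max N 1"
  from x obtain m a k where w: "\<And>t. \<bar>t\<bar> \<le> N' \<Longrightarrow>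
     0 \<le> t + k \<and> t + k < int p ^ m \<and> x t = iterate \<tau> m a ! nat (t + k)"
    unfolding points_def by blast
  have "1 \<le> m" using w[of 0] w[of 1] by (cases m) (simp_all add: N'_def, linarith)
  obtain M where M: "\<And>a b. \<exists>i. 0 \<le> i \<and> i < int p ^ M \<and> a = iterate \<tau> M b ! nat i"
    using letter_occurs by blast
  have "\<exists>i. agree_upto N x (inflate (m + M) i w)" for w
  proof -
    obtain j where j: "0 \<le> j" "j < int p ^ M" "a = iterate \<tau> M (w 0) ! nat j" using M by blast
    then have "inflate M j w 0 = a" by (simp add: inflate_letter)
    then have "x t = inflate m k (inflate M j w) t" if "\<bar>t\<bar> \<le> N" for t
      using w[of t] that by (simp add: inflate_letter N'_def)
    then show ?thesis unfolding inflate_inflate agree_upto_def by blast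
  qed
  with \<open>1 \<le> m\<close> show ?thesis by (intro exI[of _ "m + M"]) simp
qed

text \<open>A limit point of the words \<open>\<tau>\<^sup>n(a)\<close> with their middle moved to \<open>0\<close>.\<close>

lemma points_nonempty: "points \<noteq> {}"
proof -
  fix a :: 'a
  define c where "c = (\<lambda>n. int p ^ n div 2)"
  have c: "int n \<le> c (Suc n)" "c (Suc n) + int n < int p ^ Suc n" for n
  proof -
    have "int n + 1 \<le> int p ^ n" using n_less_p_power[of n] by linarith
    then have "2 * (int n + 1) \<le> int p * int p ^ n"
      using length_ge_2 by (intro mult_mono) simp_all
    moreover define P where "P = int p ^ Suc n"
    ultimately have "2 * (int n + 1) \<le> P" by simp
    then have "int n \<le> P div 2 \<and> P div 2 + int n < P" by presburger
    then show "int n \<le> c (Suc n)" "c (Suc n) + int n < int p ^ Suc n"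
      unfolding c_def P_def[symmetric] by simp_all
  qed
  define u where "u = (\<lambda>n t. iterate \<tau> (Suc n) a ! nat (t + c (Suc n)))"
  obtain x where x: "\<And>N. \<exists>k\<ge>N. agree_upto (int N) x (u k)"
    using full_shift_limit_point[of UNIV u] by auto
  have "x \<in> points"
    unfolding points_def
  proof (intro CollectI allI)
    fix N
    obtain k where k: "k \<ge> nat N" "agree_upto (int (nat N)) x (u k)" using x by blast
    have "0 \<le> t + c (Suc k) \<and> t + c (Suc k) < int p ^ Suc k \<and> x t = iterate \<tau> (Suc k) a ! nat (t + c (Suc k))"
      if t: "\<bar>t\<bar> \<le> N" for t
    proof -
      have "\<bar>t\<bar> \<le> int (nat N)" "int (nat N) \<le> int k" using t k(1) by linarith+
      then have "x t = u k t" "\<bar>t\<bar> \<le> int k" using agree_uptoD[OF k(2)] by auto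
      then show ?thesis using c[of k] unfolding u_def by linarith
    qed
    then show "\<exists>n a i. \<forall>t. \<bar>t\<bar> \<le> N \<longrightarrow> 0 \<le> t + i \<and> t + i < int p ^ n \<and> x t = iterate \<tau> n a ! nat (t + i)"
      by blast
  qed
  then show ?thesis by blast
qed

lemma subshift_points: "subshift points"
  unfolding subshift_def closedin_full_shift_iff
proof
  show "\<forall>x. (\<forall>N. \<exists>y\<in>points. agree_upto N x y) \<longrightarrow> x \<in> points"
    using points_closed by blast
  have "shift x \<in> points" if "x \<in> points" for x
    using shift_points[OF that, of 1] by (simp add: shift_def)
  moreover have "x \<in> shift ` points" if "x \<in> points" for x
  proof
    show "(\<lambda>t. x (t + -1)) \<in> points" by (rule shift_points[OF that])
    show "x = shift (\<lambda>t. x (t + -1))" by (simp add: shift_def)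
  qed
  ultimately show "shift ` points = points" by blast
qed

lemma closedin_points: "closedin full_shift_topology points"
  using subshift_points by (simp add: subshift_def)

lemma point_with_letter: obtains x where "x \<in> points" "x 0 = a"
proof -
  obtain w where w: "w \<in> points" using points_nonempty by blast
  obtain n where "\<And>b. \<exists>i. 0 \<le> i \<and> i < int p ^ n \<and> a = iterate \<tau> n b ! nat i"
    using letter_occurs by blast
  then obtain i where "0 \<le> i" "i < int p ^ n" "a = iterate \<tau> n (w 0) ! nat i" by blast
  then have "inflate n i w 0 = a" by (simp add: inflate_letter)
  with inflate_points[OF w] show ?thesis by (rule that)
qed

text \<open>The set \<open>points\<close> is itself one of the subshifts that are intersected; and each of these
  contains it, since a window of a point occurs in some \<open>\<tau>\<^sup>n(a)\<close>, hence in the closed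
  shift-invariant set.\<close>

theorem substitution_subshift_eq_points: "substitution_subshift \<tau> = points"
proof
  have "appears_in (iterate \<tau> n a) points" for n a
  proof -
    obtain x where x: "x \<in> points" "x 0 = a" by (rule point_with_letter)
    have "inflate n 0 x (0 + int j) = iterate \<tau> n a ! j" if "j < p ^ n" for j
    proof -
      have "int j < int p ^ n" using that by (metis of_nat_less_iff of_nat_power)
      then show ?thesis by (simp add: inflate_letter x)
    qed
    with inflate_points[OF x(1)] show ?thesis unfolding appears_in_def by (metis length_iterate)
  qed
  with subshift_points show "substitution_subshift \<tau> \<subseteq> points"
    unfolding substitution_subshift_def by blast
next
  show "points \<subseteq> substitution_subshift \<tau>"
    unfolding substitution_subshift_def
  proof clarify
    fix x Y assume x: "x \<in> points" and Y: "subshift Y" and app: "\<forall>n a. appears_in (iterate \<tau> n a) Y"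
    have "\<exists>y\<in>Y. agree_upto N x y" for N
    proof -
      from x obtain n a i where w: "\<And>t. \<bar>t\<bar> \<le> N \<Longrightarrow>
          0 \<le> t + i \<and> t + i < int p ^ n \<and> x t = iterate \<tau> n a ! nat (t + i)"
        unfolding points_def by blast
      from app obtain y s where y: "y \<in> Y" "\<And>j. j < p ^ n \<Longrightarrow> y (s + int j) = iterate \<tau> n a ! j"
        unfolding appears_in_def by (metis length_iterate)
      have eq: "x t = y (t + (s + i))" if "\<bar>t\<bar> \<le> N" for t
      proof -
        have "nat (t + i) < p ^ n" using w[OF that] by (simp add: nat_less_iff)
        from y(2)[OF this] w[OF that] show ?thesis by (simp add: algebra_simps)
      qed
      show ?thesis
        using eq subshift_shift_invariant[OF Y y(1), of "s + i"]
        by (intro bexI[of _ "\<lambda>t. y (t + (s + i))"]) (simp_all add: agree_upto_def)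
    qed
    with Y show "x \<in> Y" unfolding subshift_def closedin_full_shift_iff by blast
  qed
qed

section \<open>Desubstitution and minimality\<close>

lemma agree_upto_inflate:
  assumes "agree_upto (N + \<bar>i\<bar>) x y"
  shows "agree_upto N (inflate n i x) (inflate n i y)"
  unfolding agree_upto_def
proof (intro allI impI)
  fix t assume t: "\<bar>t\<bar> \<le> N"
  have "\<bar>(t + i) div int p ^ n\<bar> \<le> \<bar>t + i\<bar>" 
    using int_p_power_pos[of n] by (intro abs_div_le) linarith
  also have "\<dots> \<le> N + \<bar>i\<bar>" using t by linarith
  finally show "inflate n i x t = inflate n i y t"
    by (intro inflate_cong agree_uptoD[OF assms])
qed

text \<open>Compactness for equations between images: an approximate solution on every window gives an
  exact one. The shifts \<open>i\<close>, \<open>j\<close> and the points are passed to the limit together, so any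
  relation \<open>R\<close> between the shifts survives.\<close>

lemma inflate_limit:
  assumes closed: "closedin full_shift_topology C" "closedin full_shift_topology D"
    and fin: "finite I" "finite J"
    and approx: "\<And>N::nat. \<exists>i\<in>I. \<exists>j\<in>J. R i j \<and>
      (\<exists>x\<in>C. \<exists>y\<in>D. agree_upto (int N) (inflate m i x) (inflate n j y))"
  shows "\<exists>i\<in>I. \<exists>j\<in>J. R i j \<and> (\<exists>x\<in>C. \<exists>y\<in>D. inflate m i x = inflate n j y)"
proof -
  from approx obtain i j x y where ij: "\<And>N. i N \<in> I" "\<And>N. j N \<in> J" "\<And>N. R (i N) (j N)"
    and xy: "\<And>N. x N \<in> C" "\<And>N. y N \<in> D"
    and agr: "\<And>N. agree_upto (int N) (inflate m (i N) (x N)) (inflate n (j N) (y N))"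
    by metis
  define u where "u = (\<lambda>N t. (i N, j N, x N t, y N t))"
  have "finite (I \<times> J \<times> (UNIV :: 'a set) \<times> (UNIV :: 'a set))" using fin by simp
  moreover have "u k t \<in> I \<times> J \<times> UNIV \<times> UNIV" for k t using ij by (simp add: u_def)
  ultimately obtain w where w: "\<And>N. \<exists>k\<ge>N. agree_upto (int N) w (u k)"
    using full_shift_limit_point[of _ u] by blast
  define i0 j0 x0 y0 where "i0 = fst (w 0)" and "j0 = fst (snd (w 0))"
    and "x0 = (\<lambda>t. fst (snd (snd (w t))))" and "y0 = (\<lambda>t. snd (snd (snd (w t))))"
  have lim: "\<exists>k\<ge>N. i k = i0 \<and> j k = j0 \<and> agree_upto (int N) x0 (x k) \<and> agree_upto (int N) y0 (y k)" for N
  proof -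
    obtain k where k: "k \<ge> N" "agree_upto (int N) w (u k)" using w by blast
    from agree_uptoD[OF k(2)] have e: "w t = u k t" if "\<bar>t\<bar> \<le> int N" for t using that by blast
    have "i k = i0" "j k = j0" using e[of 0] by (simp_all add: i0_def j0_def u_def)
    moreover have "agree_upto (int N) x0 (x k)" "agree_upto (int N) y0 (y k)"
      using e by (simp_all add: agree_upto_def x0_def y0_def u_def)
    ultimately show ?thesis using k(1) by blast
  qed
  have x0: "x0 \<in> C"
  proof (rule closed(1)[unfolded closedin_full_shift_iff, rule_format])
    fix N :: int
    obtain k where "agree_upto (int (nat N)) x0 (x k)" using lim by blast
    then have "agree_upto N x0 (x k)" by (rule agree_upto_mono) simp
    with xy(1) show "\<exists>z\<in>C. agree_upto N x0 z" by blast
  qed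
  have y0: "y0 \<in> D"
  proof (rule closed(2)[unfolded closedin_full_shift_iff, rule_format])
    fix N :: int
    obtain k where "agree_upto (int (nat N)) y0 (y k)" using lim by blast
    then have "agree_upto N y0 (y k)" by (rule agree_upto_mono) simp
    with xy(2) show "\<exists>z\<in>D. agree_upto N y0 z" by blast
  qed
  have "inflate m i0 x0 = inflate n j0 y0"
  proof
    fix t
    obtain k where k: "k \<ge> nat (\<bar>t\<bar> + \<bar>i0\<bar> + \<bar>j0\<bar>)" "i k = i0" "j k = j0"
      "agree_upto (int (nat (\<bar>t\<bar> + \<bar>i0\<bar> + \<bar>j0\<bar>))) x0 (x k)"
      "agree_upto (int (nat (\<bar>t\<bar> + \<bar>i0\<bar> + \<bar>j0\<bar>))) y0 (y k)" using lim by blast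
    have "inflate m i0 x0 t = inflate m i0 (x k) t"
      by (rule agree_uptoD[OF agree_upto_inflate[of "\<bar>t\<bar>"]]) (auto intro!: agree_upto_mono[OF k(4)])
    also have "\<dots> = inflate n j0 (y k) t"
      using agree_uptoD[OF agr[of k], of t] k(1-3) by auto
    also have "\<dots> = inflate n j0 y0 t"
      by (rule agree_uptoD[OF agree_upto_inflate[of "\<bar>t\<bar>"]])
        (auto intro!: agree_upto_mono[OF agree_upto_sym[OF k(5)]])
    finally show "inflate m i0 x0 t = inflate n j0 y0 t" .
  qed
  moreover obtain k where "i k = i0" "j k = j0" using lim by blast
  then have "i0 \<in> I" "j0 \<in> J" "R i0 j0" using ij by blast+
  ultimately show ?thesis using x0 y0 by blast
qed

text \<open>Every window of \<open>z\<close> occurs in an image under \<open>\<tau>\<close>; pass to the limit.\<close>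

lemma desubstitute:
  assumes z: "z \<in> points"
  obtains i x where "0 \<le> i" "i < int p" "x \<in> points" "z = inflate 1 i x"
proof -
  obtain w where w: "w \<in> points" using points_nonempty by blast
  have "\<exists>j\<in>{0..<int p}. \<exists>x\<in>points. agree_upto (int N) z (inflate 1 j x)" for N
  proof -
    obtain n where n: "1 \<le> n" "\<And>w. \<exists>i. agree_upto (int N) z (inflate n i w)"
      using window_in_inflation[OF z] by blast
    then obtain i where i: "agree_upto (int N) z (inflate n i w)" by blast
    have "inflate n i w = inflate 1 (i mod int p) (inflate (n - 1) (i div int p) w)"
      using n(1) inflate_inflate[of 1 "i mod int p" "n - 1" "i div int p" w] by simp
    with i inflate_points[OF w] show ?thesis
      using length_ge_2 by (intro bexI[of _ "i mod int p"]) auto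
  qed
  then have "\<exists>i\<in>{0}. \<exists>j\<in>{0..<int p}. True \<and>
      (\<exists>x\<in>{z}. \<exists>y\<in>points. agree_upto (int N) (inflate 0 i x) (inflate 1 j y))" for N
    by simp
  from inflate_limit[OF closedin_full_shift_singleton closedin_points _ _ this]
  obtain j x where "0 \<le> j" "j < int p" "x \<in> points" "z = inflate 1 j x" by auto
  then show ?thesis by (rule that)
qed

text \<open>If the shifts in \<open>D\<close> suffice to desubstitute once, then the numbers with \<open>n\<close> digits in base
  \<open>p\<close>, all of them from \<open>D\<close>, suffice to desubstitute \<open>n\<close> times.\<close>

lemma inflate_cover:
  assumes D: "D \<subseteq> {0..<int p}"
    and cover: "\<And>z. z \<in> points \<Longrightarrow> \<exists>i\<in>D. \<exists>x\<in>points. z = inflate 1 i x"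
  shows "\<exists>I\<subseteq>{0..<int p ^ n}. card I \<le> card D ^ n \<and> (\<forall>z\<in>points. \<exists>i\<in>I. \<exists>x\<in>points. z = inflate n i x)"
proof (induction n)
  case 0
  show ?case by (rule exI[of _ "{0}"]) simp
next
  case (Suc n)
  then obtain I where I: "I \<subseteq> {0..<int p ^ n}" "card I \<le> card D ^ n"
      "\<And>z. z \<in> points \<Longrightarrow> \<exists>i\<in>I. \<exists>x\<in>points. z = inflate n i x" by blast
  define J where "J = (\<lambda>(i, d). i + int p ^ n * d) ` (I \<times> D)"
  have fin: "finite I" "finite D" using I(1) D finite_subset by blast+
  have "card J \<le> card (I \<times> D)" unfolding J_def using fin by (intro card_image_le) simp
  also have "\<dots> \<le> card D ^ Suc n" using I(2) by (simp add: card_cartesian_product mult.commute)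
  finally have "card J \<le> card D ^ Suc n" .
  moreover have "J \<subseteq> {0..<int p ^ Suc n}"
  proof -
    have "0 \<le> i + int p ^ n * d \<and> i + int p ^ n * d < int p ^ Suc n" if "i \<in> I" "d \<in> D" for i d
    proof -
      have "0 \<le> i" "i < int p ^ n" "0 \<le> d" "d \<le> int p - 1" using that I(1) D by force+
      moreover from this have "int p ^ n * d \<le> int p ^ n * (int p - 1)"
        by (intro mult_left_mono) auto
      ultimately show ?thesis by (simp add: algebra_simps)
    qed
    then show ?thesis by (auto simp: J_def)
  qed
  moreover have "\<exists>j\<in>J. \<exists>x\<in>points. z = inflate (Suc n) j x" if z: "z \<in> points" for z
  proof -
    obtain i y where i: "i \<in> I" "y \<in> points" "z = inflate n i y" using I(3)[OF z] by blast
    obtain d x where d: "d \<in> D" "x \<in> points" "y = inflate 1 d x" using cover[OF i(2)] by blast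
    have "z = inflate (Suc n) (i + int p ^ n * d) x"
      unfolding i(3) d(3) inflate_inflate by simp
    moreover have "i + int p ^ n * d \<in> J" unfolding J_def using i(1) d(1) by force
    ultimately show ?thesis using d(2) by blast
  qed
  ultimately show ?case by blast
qed

lemma desubstitute_power:
  assumes "z \<in> points"
  obtains i x where "x \<in> points" "z = inflate n i x"
  using inflate_cover[of "{0..<int p}" n] desubstitute assms
  by (metis atLeastLessThan_iff subset_refl)

text \<open>Desubstitute \<open>w\<close> so far that every block contains the given window of \<open>x\<close>.\<close>

lemma minimality:
  assumes "x \<in> points" "w \<in> points"
  obtains s where "agree_upto N x (\<lambda>t. w (t + s))"
proof -
  obtain n where n: "\<And>w. \<exists>i. agree_upto N x (inflate n i w)"
    using window_in_inflation[OF assms(1)] by blast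
  obtain k v where v: "w = inflate n k v" using desubstitute_power[OF assms(2)] by blast
  obtain i where i: "agree_upto N x (inflate n i v)" using n by blast
  have "inflate n i v = (\<lambda>t. w (t + (i - k)))" unfolding v inflate_shift by simp
  with i that show ?thesis by metis
qed

section \<open>Recognizability\<close>

text \<open>A window of length \<open>p\<^sup>n\<close> meets at most two neighbouring blocks of length \<open>p\<^sup>n\<close>, so it is
  determined by the shift \<open>i\<close> and two letters.\<close>

lemma card_windows_le:
  assumes I: "I \<subseteq> {0..<int p ^ n}"
    and cover: "\<And>z. z \<in> points \<Longrightarrow> \<exists>i\<in>I. \<exists>x\<in>points. z = inflate n i x"
  shows "card ((\<lambda>x. restrict x {0..<int p ^ n}) ` points) \<le> card I * CARD('a)\<^sup>2"
proof -
  \<comment> \<open>outside the two coordinates that matter, the point is filled up with \<open>b\<close>\<close>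
  define F where "F = (\<lambda>(i, a, b). restrict (inflate n i (\<lambda>s. if s = 0 then a else b)) {0..<int p ^ n})"
  have "restrict z {0..<int p ^ n} \<in> F ` (I \<times> UNIV \<times> UNIV)" if z: "z \<in> points" for z
  proof -
    obtain i x where i: "i \<in> I" "z = inflate n i x" using cover[OF z] by blast
    have "restrict z {0..<int p ^ n} = F (i, x 0, x 1)"
      unfolding F_def prod.case i(2)
    proof (rule restrict_ext)
      fix t assume t: "t \<in> {0..<int p ^ n}"
      have "0 \<le> t + i" "t + i < 2 * int p ^ n" using t i(1) I by auto
      then have "0 \<le> (t + i) div int p ^ n" by (simp add: pos_imp_zdiv_nonneg_iff)
      moreover have "int p ^ n * ((t + i) div int p ^ n) < int p ^ n * 2"
        using \<open>t + i < _\<close> pos_mod_sign[OF int_p_power_pos, of "t + i" n]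
        unfolding minus_mod_eq_mult_div[symmetric] by linarith
      then have "(t + i) div int p ^ n < 2" by (subst (asm) mult_less_cancel_left_pos) simp_all
      ultimately have "(t + i) div int p ^ n = 0 \<or> (t + i) div int p ^ n = 1" by linarith
      then show "inflate n i x t = inflate n i (\<lambda>s. if s = 0 then x 0 else x 1) t"
        by (intro inflate_cong) auto
    qed
    with i(1) show ?thesis by blast
  qed
  then have "(\<lambda>x. restrict x {0..<int p ^ n}) ` points \<subseteq> F ` (I \<times> UNIV \<times> UNIV)" by blast
  moreover have fin: "finite (I \<times> (UNIV::'a set) \<times> (UNIV::'a set))"
    using finite_subset[OF I] by simp
  ultimately have "card ((\<lambda>x. restrict x {0..<int p ^ n}) ` points) \<le> card (I \<times> (UNIV::'a set) \<times> (UNIV::'a set))"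
    by (meson card_image_le card_mono finite_imageI le_trans)
  then show ?thesis by (simp add: card_cartesian_product power2_eq_square)
qed

text \<open>Minimality moves the given coincidence from \<open>a\<close> to all \<open>c \<in> points\<close>. So the shift \<open>i\<close> can
  be dropped from the list of shifts needed for desubstitution, and counting words contradicts
  \<open>card_windows_gt\<close>.\<close>

theorem recognizability:
  assumes inf: "infinite points"
    and ab: "a \<in> points" "b \<in> points"
    and ij: "0 \<le> i" "i < int p" "0 \<le> j" "j < int p"
    and eq: "inflate 1 i a = inflate 1 j b"
  shows "i = j"
proof (rule ccontr)
  assume ne: "i \<noteq> j"
  have move: "\<exists>d\<in>points. inflate 1 i c = inflate 1 j d" if c: "c \<in> points" for c
  proof -
    have "\<exists>d\<in>points. agree_upto (int N) (inflate 1 i c) (inflate 1 j d)" for N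
    proof -
      obtain s where s: "agree_upto (int N + \<bar>i\<bar>) c (\<lambda>t. a (t + s))"
        by (rule minimality[OF c ab(1)])
      have "inflate 1 k (\<lambda>t. z (t + s)) = (\<lambda>t. inflate 1 k z (t + int p * s))" for k z
        using inflate_inflate[of 1 k 0 s z] by (simp add: inflate_shift)
      then have "inflate 1 i (\<lambda>t. a (t + s)) = inflate 1 j (\<lambda>t. b (t + s))" using eq by simp
      with agree_upto_inflate[OF s, of 1] shift_points[OF ab(2), of s] show ?thesis by metis
    qed
    then have "\<exists>i'\<in>{i}. \<exists>j'\<in>{j}. True \<and>
      (\<exists>x\<in>{c}. \<exists>y\<in>points. agree_upto (int N) (inflate 1 i' x) (inflate 1 j' y))" for N
      by simp
    from inflate_limit[OF closedin_full_shift_singleton closedin_points _ _ this]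
    show ?thesis by auto
  qed
  define D where "D = {0..<int p} - {i}"
  have cardD: "card D = p - 1" using ij by (simp add: D_def)
  have cover: "\<exists>i\<in>D. \<exists>x\<in>points. z = inflate 1 i x" if "z \<in> points" for z
  proof -
    obtain k x where k: "0 \<le> k" "k < int p" "x \<in> points" "z = inflate 1 k x"
      by (rule desubstitute[OF \<open>z \<in> points\<close>])
    show ?thesis
    proof (cases "k = i")
      case True
      with move[OF k(3)] k ij ne show ?thesis by (intro bexI[of _ j]) (auto simp: D_def)
    next
      case False
      with k show ?thesis by (auto simp: D_def)
    qed
  qed
  have bound: "p ^ n < (p - 1) ^ n * CARD('a)\<^sup>2" for n
  proof -
    obtain I where I: "I \<subseteq> {0..<int p ^ n}" "card I \<le> (p - 1) ^ n"
        "\<And>z. z \<in> points \<Longrightarrow> \<exists>i\<in>I. \<exists>x\<in>points. z = inflate n i x"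
      using inflate_cover[of D n, OF _ cover] unfolding cardD by (auto simp: D_def)
    have "p ^ n < card ((\<lambda>x. restrict x {0..<int p ^ n}) ` points)"
      using card_windows_gt[OF inf shift_points, of "p ^ n"] by simp
    also have "\<dots> \<le> card I * CARD('a)\<^sup>2" by (rule card_windows_le[OF I(1,3)])
    also have "\<dots> \<le> (p - 1) ^ n * CARD('a)\<^sup>2" using I(2) by (rule mult_right_mono) simp
    finally show ?thesis .
  qed
  define c where "c = real (CARD('a)\<^sup>2)"
  have c: "0 < c" by (simp add: c_def)
  obtain n where n: "(real (p - 1) / real p) ^ n < 1 / c"
    using real_arch_pow_inv[of "1 / c" "real (p - 1) / real p"] c length_ge_2 by auto
  have "real (p ^ n) < real ((p - 1) ^ n * CARD('a)\<^sup>2)" using bound[of n] of_nat_less_iff by blast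
  then have "real p ^ n < real (p - 1) ^ n * c" by (simp add: c_def)
  moreover have "real (p - 1) ^ n * c < real p ^ n"
    using n c length_ge_2 by (simp add: power_divide divide_simps split: if_splits)
  ultimately show False by linarith
qed

section \<open>From letters to Li--Yorke pairs\<close>

text \<open>Iterating from a point with the letter \<open>a\<close> at \<open>0\<close> keeps this letter. Because \<open>r\<close> is not
  the last place of the block, the part that no longer changes grows by at least one coordinate
  to the right in each step.\<close>

lemma right_fixed_point:
  assumes r: "0 \<le> r" "r + 1 < int p ^ m" and a: "iterate \<tau> m a ! nat r = a"
  shows "\<exists>x\<in>points. x 0 = a \<and> (\<forall>t\<ge>0. x t = inflate m r x t)"
proof -
  define q where "q = int p ^ m"
  have q: "2 \<le> q" "r + 1 < q" using r by (simp_all add: q_def)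
  have anc: "0 \<le> (t + r) div q" "(t + r) div q \<le> N" if "0 \<le> t" "t \<le> N + 1" "0 \<le> N" for t N
  proof -
    show "0 \<le> (t + r) div q" using q r that by (simp add: pos_imp_zdiv_nonneg_iff)
    have "1 * N \<le> q * N" using q that by (intro mult_right_mono) auto
    then have "t + r < q * (N + 1)" using q that by (simp add: algebra_simps)
    then have "q * ((t + r) div q) < q * (N + 1)"
      using pos_mod_sign[of q "t + r"] q(1) unfolding minus_mod_eq_mult_div[symmetric] by linarith
    then have "(t + r) div q < N + 1" using q(1) by (subst (asm) mult_less_cancel_left_pos) simp_all
    then show "(t + r) div q \<le> N" by simp
  qed
  obtain w where w: "w \<in> points" "w 0 = a" by (rule point_with_letter)
  define X where "X = (\<lambda>n. (inflate m r ^^ n) w)"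
  have XS: "X (Suc n) = inflate m r (X n)" for n by (simp add: X_def)
  have Xp: "X n \<in> points" for n by (induction n) (simp_all add: XS inflate_points, simp add: X_def w)
  have X0: "X n 0 = a" for n
  proof (induction n)
    case 0
    show ?case by (simp add: X_def w)
  next
    case (Suc n)
    then show ?case using r a unfolding XS by (simp add: inflate_letter)
  qed
  have stable: "X n t = X (n + k) t" if "0 \<le> t" "t \<le> int n" for n k t
    using that
  proof (induction n arbitrary: t)
    case 0
    then show ?case by (simp add: X0)
  next
    case (Suc n)
    have "X n ((t + r) div q) = X (n + k) ((t + r) div q)"
      using Suc.prems anc[of t "int n"] by (intro Suc.IH) auto
    then show ?case unfolding XS add_Suc by (intro inflate_cong) (simp add: q_def)
  qed
  obtain x where x: "x \<in> points" "\<And>N. \<exists>k\<ge>N. agree_upto (int N) x (X k)"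
    using closedin_full_shift_limit_point[of points X] closedin_points Xp by blast
  have lim: "x t = X k t" if t: "0 \<le> t" "t \<le> int k" for t k
  proof -
    obtain l where l: "l \<ge> k" "agree_upto (int k) x (X l)" using x(2) by blast
    have "x t = X l t" using l(2) by (rule agree_uptoD) (use t in simp)
    also have "\<dots> = X k t" using stable[OF t, of "l - k"] l(1) by simp
    finally show ?thesis .
  qed
  have "x t = inflate m r x t" if t: "0 \<le> t" for t
  proof -
    have "x t = X (Suc (nat t)) t" using t by (intro lim) auto
    also have "\<dots> = inflate m r x t"
      unfolding XS using lim[of "(t + r) div q" "nat t"] anc[of t t] t
      by (intro inflate_cong) (simp add: q_def)
    finally show ?thesis .
  qed
  moreover have "x 0 = a" using lim[of 0 0] X0 by simp
  ultimately show ?thesis using x(1) by blast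
qed

text \<open>Coordinate \<open>n \<ge> 1\<close> of the right fixed points produces the block starting at \<open>q n - r > n\<close>.
  So a difference at \<open>n\<close> produces one further to the right, and a run of agreement produces a
  longer run further to the right.\<close>

theorem forward_Li_Yorke_from_letters:
  assumes r: "r < j" "j < p ^ m" "r < k" "k < p ^ m"
    and ab: "iterate \<tau> m a ! r = a" "iterate \<tau> m b ! r = b"
    and j: "iterate \<tau> m a ! j \<noteq> iterate \<tau> m b ! j"
    and k: "iterate \<tau> m a ! k = iterate \<tau> m b ! k"
  shows "\<exists>x\<in>points. \<exists>y\<in>points. forward_Li_Yorke x y"
proof -
  define q where "q = int p ^ m"
  have less_q: "int t < q" if "t < p ^ m" for t
    using that unfolding q_def by (metis of_nat_less_iff of_nat_power)
  have q: "int r + 1 < q" "2 \<le> q" using r(1) less_q[OF r(2)] by linarith+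
  obtain x where x: "x \<in> points" "x 0 = a" "\<And>t. 0 \<le> t \<Longrightarrow> x t = inflate m (int r) x t"
    using right_fixed_point[of "int r" m a] q(1) ab(1) by (auto simp: q_def)
  obtain y where y: "y \<in> points" "y 0 = b" "\<And>t. 0 \<le> t \<Longrightarrow> y t = inflate m (int r) y t"
    using right_fixed_point[of "int r" m b] q(1) ab(2) by (auto simp: q_def)
  have start: "x (int t - int r) = iterate \<tau> m a ! t" "y (int t - int r) = iterate \<tau> m b ! t"
    if "r < t" "t < p ^ m" for t
    using that less_q[of t] x(2) y(2) x(3)[of "int t - int r"] y(3)[of "int t - int r"]
    by (simp_all add: inflate_letter q_def)
  have move: "n + 1 \<le> q * n - int r" if "1 \<le> n" for n
  proof -
    have "1 * (n - 1) \<le> q * (n - 1)" using q that by (intro mult_right_mono) auto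
    then show ?thesis using q(1) by (simp add: algebra_simps)
  qed
  have differ: "\<exists>n\<ge>int N. 1 \<le> n \<and> x n \<noteq> y n" for N
  proof (induction N)
    case 0
    show ?case using start[OF r(1,2)] j r(1) by (intro exI[of _ "int j - int r"]) auto
  next
    case (Suc N)
    then obtain n where n: "int N \<le> n" "1 \<le> n" "x n \<noteq> y n" by blast
    then obtain t where t: "(t + int r) div q = n" "inflate m (int r) x t \<noteq> inflate m (int r) y t"
      using inflate_eq_block[of "int r" m n x y] unfolding q_def by blast
    have "q * n \<le> t + int r"
      using t(1) pos_mod_sign[of q "t + int r"] q(2)
      unfolding t(1)[symmetric] minus_mod_eq_mult_div[symmetric] by linarith
    then have "n + 1 \<le> t" using move[OF n(2)] by linarith
    then show ?case using n t(2) x(3)[of t] y(3)[of t] by (intro exI[of _ t]) auto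
  qed
  have agree: "\<exists>n\<ge>int L. 1 \<le> n \<and> (\<forall>t. n \<le> t \<and> t \<le> n + int L \<longrightarrow> x t = y t)" for L
  proof (induction L)
    case 0
    show ?case using start[OF r(3,4)] k r(3) by (intro exI[of _ "int k - int r"]) auto
  next
    case (Suc L)
    then obtain n where n: "int L \<le> n" "1 \<le> n"
      and eq: "\<And>t. n \<le> t \<Longrightarrow> t \<le> n + int L \<Longrightarrow> x t = y t" by blast
    have "x t = y t" if t: "q * n - int r \<le> t" "t \<le> q * n - int r + int (Suc L)" for t
    proof -
      have lo: "n \<le> (t + int r) div q"
        using t(1) q(2) zdiv_mono1[of "q * n" "t + int r" q] by simp
      have "2 * (int L + 1) \<le> q * (int L + 1)" using q(2) by (intro mult_right_mono) auto
      then have "t + int r < q * (n + int L + 1)" using t(2) by (simp add: algebra_simps)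
      then have "q * ((t + int r) div q) < q * (n + int L + 1)"
        using pos_mod_sign[of q "t + int r"] q(2) unfolding minus_mod_eq_mult_div[symmetric] by linarith
      then have "(t + int r) div q < n + int L + 1"
        using q(2) by (subst (asm) mult_less_cancel_left_pos) simp_all
      with lo have "x ((t + int r) div q) = y ((t + int r) div q)" by (intro eq) auto
      then have "inflate m (int r) x t = inflate m (int r) y t"
        by (intro inflate_cong) (simp add: q_def)
      moreover have "0 \<le> t" using move[OF n(2)] n(2) t(1) by linarith
      ultimately show ?thesis using x(3) y(3) by simp
    qed
    then show ?case using move[OF n(2)] n by (intro exI[of _ "q * n - int r"]) auto
  qed
  have "forward_Li_Yorke x y"
    unfolding forward_Li_Yorke_def
  proof (intro conjI allI)
    fix N :: int
    obtain n where "int (nat N) \<le> n" "x n \<noteq> y n" using differ[of "nat N"] by blast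
    moreover from this have "N \<le> n" by linarith
    ultimately show "\<exists>n\<ge>N. x n \<noteq> y n" by blast
  next
    fix N :: int
    obtain n where "int (nat N) \<le> n" "\<And>t. n \<le> t \<Longrightarrow> t \<le> n + int (nat N) \<Longrightarrow> x t = y t"
      using agree[of "nat N"] by blast
    moreover from this(1) have "N \<le> n" by linarith
    moreover have "t \<le> n + int (nat N)" if "t \<le> n + N" for t using that by linarith
    ultimately show "\<exists>n\<ge>N. \<forall>t. n \<le> t \<and> t \<le> n + N \<longrightarrow> x t = y t" by blast
  qed
  with x(1) y(1) show ?thesis by blast
qed

section \<open>From Li--Yorke pairs to letters\<close>

text \<open>If the two shifts were different, they would remain different modulo \<open>p\<close> after moving to
  the middle of any run of agreement. The limit of longer and longer such runs would be a point
  with two different positions in the blocks, against recognizability.\<close>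

lemma forward_Li_Yorke_desubstitute:
  assumes inf: "infinite points"
    and xy: "x \<in> points" "y \<in> points" and LY: "forward_Li_Yorke x y"
  shows "\<exists>i x' y'. x' \<in> points \<and> y' \<in> points \<and> x = inflate 1 i x' \<and> y = inflate 1 i y' \<and>
    forward_Li_Yorke x' y'"
proof -
  obtain i x' where i: "0 \<le> i" "i < int p" and x': "x' \<in> points" "x = inflate 1 i x'"
    by (rule desubstitute[OF xy(1)])
  obtain j y' where j: "0 \<le> j" "j < int p" and y': "y' \<in> points" "y = inflate 1 j y'"
    by (rule desubstitute[OF xy(2)])
  have "i = j"
  proof (rule ccontr)
    assume ne: "i \<noteq> j"
    let ?I = "{0..<int p}"
    have "\<exists>i'\<in>?I. \<exists>j'\<in>?I. i' \<noteq> j' \<and>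
        (\<exists>u\<in>points. \<exists>v\<in>points. agree_upto (int N) (inflate 1 i' u) (inflate 1 j' v))" for N
    proof -
      obtain n where n: "\<And>t. n \<le> t \<Longrightarrow> t \<le> n + 2 * int N \<Longrightarrow> x t = y t"
        using LY unfolding forward_Li_Yorke_def by blast
      define c where "c = n + int N"
      have "agree_upto (int N) (\<lambda>t. x (t + c)) (\<lambda>t. y (t + c))"
        unfolding agree_upto_def c_def by (auto intro!: n)
      then have "agree_upto (int N) (inflate 1 (i + c) x') (inflate 1 (j + c) y')"
        unfolding x'(2) y'(2) inflate_shift .
      then have "agree_upto (int N) (inflate 1 ((i + c) mod int p) (\<lambda>t. x' (t + (i + c) div int p)))
          (inflate 1 ((j + c) mod int p) (\<lambda>t. y' (t + (j + c) div int p)))"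
        using inflate_normalize[of 1] by simp
      moreover have "((k + c) mod int p - c) mod int p = k" if "0 \<le> k" "k < int p" for k
        using that by (simp add: mod_diff_left_eq)
      with i j ne have "(i + c) mod int p \<noteq> (j + c) mod int p" by metis
      moreover have "(i + c) mod int p \<in> ?I" "(j + c) mod int p \<in> ?I" by simp_all
      ultimately show ?thesis using shift_points x'(1) y'(1) by blast
    qed
    from inflate_limit[OF closedin_points closedin_points _ _ this]
    obtain i' j' u v where "i' \<in> ?I" "j' \<in> ?I" "i' \<noteq> j'" "u \<in> points" "v \<in> points"
        "inflate 1 i' u = inflate 1 j' v" by blast
    with recognizability[OF inf] show False by auto
  qed
  with y' have y: "y = inflate 1 i y'" by simp
  have "forward_Li_Yorke x' y'"
    unfolding forward_Li_Yorke_def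
  proof (intro conjI allI)
    fix N :: int
    obtain n where n: "n \<ge> int p * N" "x n \<noteq> y n"
      using LY unfolding forward_Li_Yorke_def by blast
    have "N \<le> (n + i) div int p"
      using n(1) i zdiv_mono1[of "int p * N" "n + i" "int p"] by simp
    moreover have "x' ((n + i) div int p) \<noteq> y' ((n + i) div int p)"
      using n(2) inflate_cong[of x' n i 1 y'] unfolding x'(2) y by auto
    ultimately show "\<exists>n\<ge>N. x' n \<noteq> y' n" by blast
  next
    fix L :: int
    \<comment> \<open>two blocks more than \<open>M\<close>, since the outermost ones may be cut by the window\<close>
    define M where "M = max L 0"
    obtain n where n: "n \<ge> int p * (M + 2)"
      "\<And>t. n \<le> t \<Longrightarrow> t \<le> n + int p * (M + 2) \<Longrightarrow> x t = y t"
      using LY unfolding forward_Li_Yorke_def by blast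
    define n' where "n' = (n + i) div int p + 1"
    have "M + 2 \<le> (n + i) div int p"
      using n(1) i zdiv_mono1[of "int p * (M + 2)" "n + i" "int p"] by simp
    then have "L \<le> n'" by (simp add: n'_def M_def)
    moreover have "x' t = y' t" if t: "n' \<le> t" "t \<le> n' + L" for t
    proof (rule inflate_eq_block[of i 1])
      fix s assume "(s + i) div int p ^ 1 = t"
      then have s: "s + i = int p * t + (s + i) mod int p"
        using mult_div_mod_eq[of "int p" "s + i"] by simp
      have m: "0 \<le> (s + i) mod int p" "(s + i) mod int p < int p" by simp_all
      have n'': "int p * n' = n + i - (n + i) mod int p + int p"
        using mult_div_mod_eq[of "int p" "n + i"] by (simp add: n'_def algebra_simps)
      have m': "0 \<le> (n + i) mod int p" "(n + i) mod int p < int p" by simp_all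
      have "int p * n' \<le> int p * t" using t(1) by (intro mult_left_mono) auto
      then have "n \<le> s" using s m n'' m' by linarith
      moreover have "int p * t \<le> int p * (n' + M)" using t(2) by (intro mult_left_mono) (auto simp: M_def)
      then have "s \<le> n + int p * (M + 2)"
        using s m n'' m' unfolding distrib_left by linarith
      ultimately have "x s = y s" by (rule n(2))
      then show "inflate 1 i x' s = inflate 1 i y' s" unfolding x'(2) y .
    qed
    ultimately show "\<exists>n\<ge>L. \<forall>t. n \<le> t \<and> t \<le> n + L \<longrightarrow> x' t = y' t" by blast
  qed
  with x' y' y show ?thesis by blast
qed

text \<open>Two occurrences of one pair of letters above a position \<open>n\<close> give the wanted words once the
  upper block reaches far enough to the right of the lower letter. So \<open>n\<close> is chosen such that
  \<open>room n l\<close>, the number of positions to the right of \<open>n\<close> in its block of level \<open>l\<close>, tends to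
  infinity along an infinite set of levels; \<open>pos n l\<close> is the coordinate above \<open>n\<close> on level \<open>l\<close>.\<close>

theorem letters_from_forward_Li_Yorke:
  assumes inf: "infinite points"
    and xy: "x \<in> points" "y \<in> points" and LY: "forward_Li_Yorke x y"
  shows "\<exists>m a b r j k. a \<noteq> b \<and> r < j \<and> j < p ^ m \<and> r < k \<and> k < p ^ m \<and>
    iterate \<tau> m a ! r = a \<and> iterate \<tau> m b ! r = b \<and>
    iterate \<tau> m a ! j \<noteq> iterate \<tau> m b ! j \<and> iterate \<tau> m a ! k = iterate \<tau> m b ! k"
proof -
  have "\<exists>f. \<forall>n. (fst (f n) \<in> points \<and> snd (f n) \<in> points \<and> forward_Li_Yorke (fst (f n)) (snd (f n)) \<and>
        (n = 0 \<longrightarrow> f n = (x, y))) \<and>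
      (\<exists>i. fst (f n) = inflate 1 i (fst (f (Suc n))) \<and> snd (f n) = inflate 1 i (snd (f (Suc n))))"
    (is "\<exists>f. \<forall>n. ?P n (f n) \<and> ?Q n (f n) (f (Suc n))")
  proof (rule dependent_nat_choice)
    show "\<exists>z. ?P 0 z" using xy LY by (intro exI[of _ "(x, y)"]) simp
  next
    fix z n assume "?P n z"
    then obtain i x' y' where "x' \<in> points" "y' \<in> points" "fst z = inflate 1 i x'"
        "snd z = inflate 1 i y'" "forward_Li_Yorke x' y'"
      using forward_Li_Yorke_desubstitute[OF inf, of "fst z" "snd z"] by blast
    then show "\<exists>z'. ?P (Suc n) z' \<and> ?Q n z z'" by (intro exI[of _ "(x', y')"]) auto
  qed
  then obtain f where f: "\<And>n. ?P n (f n) \<and> ?Q n (f n) (f (Suc n))" by blast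
  define X Y where "X = (\<lambda>n. fst (f n))" and "Y = (\<lambda>n. snd (f n))"
  have XY0: "X 0 = x" "Y 0 = y" using f[of 0] by (simp_all add: X_def Y_def)
  have LYn: "forward_Li_Yorke (X n) (Y n)" for n using f[of n] by (simp add: X_def Y_def)
  have "\<forall>n. \<exists>i. X n = inflate 1 i (X (Suc n)) \<and> Y n = inflate 1 i (Y (Suc n))"
    using f by (simp add: X_def Y_def)
  then obtain d where d: "\<And>n. X n = inflate 1 (d n) (X (Suc n))" "\<And>n. Y n = inflate 1 (d n) (Y (Suc n))"
    by metis
  \<comment> \<open>total shift of the \<open>e\<close> desubstitutions that lead from level \<open>k\<close> to level \<open>k + e\<close>\<close>
  define D where "D = (\<lambda>k e. \<Sum>i<e. int p ^ i * d (k + i))"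
  have D: "X k = inflate e (D k e) (X (k + e)) \<and> Y k = inflate e (D k e) (Y (k + e))" for k e
  proof (induction e)
    case 0
    show ?case by (simp add: D_def)
  next
    case (Suc e)
    have S: "D k (Suc e) = D k e + int p ^ e * d (k + e)" by (simp add: D_def)
    have "inflate e (D k e) (X (k + e)) = inflate (e + 1) (D k (Suc e)) (X (k + Suc e))"
      unfolding d(1)[of "k + e"] inflate_inflate S by simp
    moreover have "inflate e (D k e) (Y (k + e)) = inflate (e + 1) (D k (Suc e)) (Y (k + Suc e))"
      unfolding d(2)[of "k + e"] inflate_inflate S by simp
    ultimately show ?case using Suc by simp
  qed
  have D_add: "D 0 (k + e) = D 0 k + int p ^ k * D k e" for k e
    by (induction e) (simp_all add: D_def power_add algebra_simps)
  define pos where "pos = (\<lambda>n l. (n + D 0 l) div int p ^ l)"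
  define room where "room = (\<lambda>n l. int p ^ l - 1 - (n + D 0 l) mod int p ^ l)"
  have LY': "\<exists>n\<ge>N. x n \<noteq> y n" for N using LY unfolding forward_Li_Yorke_def by blast
  \<comment> \<open>a position of difference whose blocks reach arbitrarily far to the right on the levels in \<open>S\<close>\<close>
  obtain n S where n: "x n \<noteq> y n" and S: "infinite S"
    and S_room: "\<And>B. \<exists>l0. \<forall>l\<in>S. l0 \<le> l \<longrightarrow> B \<le> room n l"
  proof -
    obtain n where n: "x n \<noteq> y n" using LY' by blast
    show ?thesis
    proof (cases "\<exists>B. infinite {l. room n l \<le> B}")
      case False
      have "\<exists>l0. \<forall>l\<in>UNIV. l0 \<le> l \<longrightarrow> B \<le> room n l" for B
      proof -
        have "finite {l. room n l \<le> B}" using False by blast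
        then obtain l0 where l0: "\<forall>l\<in>{l. room n l \<le> B}. l < l0"
          using finite_nat_set_iff_bounded by blast
        have "B \<le> room n l" if "l0 \<le> l" for l
        proof (rule ccontr)
          assume "\<not> B \<le> room n l"
          then have "l < l0" using l0 by simp
          with that show False by simp
        qed
        then show ?thesis by blast
      qed
      with n that[of n UNIV] show ?thesis by blast
    next
      case True
      then obtain B where B: "infinite {l. room n l \<le> B}" by blast
      obtain n' where n': "n' \<ge> n + max B 0 + 1" "x n' \<noteq> y n'" using LY' by blast
      define \<Delta> where "\<Delta> = n' - n"
      have "\<exists>l0. \<forall>l\<in>{l. room n l \<le> B}. l0 \<le> l \<longrightarrow> C \<le> room n' l" for C
      proof (intro exI ballI impI)
        fix l assume l: "l \<in> {l. room n l \<le> B}" "nat (\<Delta> + max C 0) \<le> l"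
        define q where "q = int p ^ l"
        have q: "\<Delta> + max C 0 \<le> q" using n_less_p_power[of l] l(2) unfolding q_def by linarith
        define m where "m = (n + D 0 l) mod q"
        have m: "0 \<le> m" "m < q" "q - 1 - m \<le> B"
          using l(1) by (simp_all add: m_def q_def room_def)
        \<comment> \<open>\<open>n'\<close> lies in the block that follows the block of \<open>n\<close>\<close>
        have "(n' + D 0 l) mod q = (m + \<Delta>) mod q"
          unfolding m_def \<Delta>_def mod_add_left_eq by (simp add: algebra_simps)
        also have "\<dots> = (m + \<Delta> - q) mod q" by simp
        also have "\<dots> = m + \<Delta> - q"
          using m n'(1) q by (intro mod_pos_pos_trivial) (simp_all add: \<Delta>_def)
        finally show "C \<le> room n' l" using m q by (simp add: room_def q_def[symmetric])
      qed
      with n'(2) B that[of n' "{l. room n l \<le> B}"] show ?thesis by blast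
    qed
  qed
  \<comment> \<open>the pair of letters above \<open>n\<close>, repeated on the infinite set \<open>S'\<close> of levels\<close>
  define g where "g = (\<lambda>l. (X l (pos n l), Y l (pos n l)))"
  have "finite (g ` S)" by (rule finite_subset[OF subset_UNIV]) simp
  from pigeonhole_infinite[OF S this] obtain l1 where l1: "l1 \<in> S" "infinite {l\<in>S. g l = g l1}" by blast
  define a b where "a = fst (g l1)" and "b = snd (g l1)"
  define S' where "S' = {l\<in>S. g l = g l1}"
  have S': "X l (pos n l) = a" "Y l (pos n l) = b" "l \<in> S" if "l \<in> S'" for l
    using that by (auto simp: S'_def a_def b_def g_def)
  have S'_inf: "\<exists>l\<ge>N. l \<in> S'" for N
    using l1(2) unfolding S'_def[symmetric] infinite_nat_iff_unbounded_le by blast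
  obtain k where k: "k \<in> S'" using S'_inf by blast
  have "a \<noteq> b"
  proof
    assume "a = b"
    then have "inflate k (D 0 k) (X k) n = inflate k (D 0 k) (Y k) n"
      using S'(1,2)[OF k] by (intro inflate_cong) (simp add: pos_def)
    with D[of 0 k] n XY0 show False by simp
  qed
  define s where "s = pos n k"
  obtain h1 where h1: "1 \<le> h1" "X k (s + h1) \<noteq> Y k (s + h1)"
  proof -
    obtain t where "t \<ge> s + 1" "X k t \<noteq> Y k t"
      using LYn[of k] unfolding forward_Li_Yorke_def by blast
    with that[of "t - s"] show ?thesis by simp
  qed
  obtain h2 where h2: "1 \<le> h2" "X k (s + h2) = Y k (s + h2)"
  proof -
    obtain t where "t \<ge> max 0 (s + 1)" "\<And>u. t \<le> u \<Longrightarrow> u \<le> t + max 0 (s + 1) \<Longrightarrow> X k u = Y k u"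
      using LYn[of k] unfolding forward_Li_Yorke_def by blast
    with that[of "t - s"] show ?thesis by simp
  qed
  define B where "B = max h1 h2"
  define P where "P = int p ^ k"
  have P: "0 < P" by (simp add: P_def)
  obtain l0 where l0: "\<And>l. l \<in> S \<Longrightarrow> l0 \<le> l \<Longrightarrow> P * B \<le> room n l" using S_room by blast
  obtain l where l: "l \<ge> max l0 k" "l \<in> S'" using S'_inf by blast
  then have rm: "P * B \<le> room n l" using l0 S'(3) by simp
  define e where "e = l - k"
  have le: "l = k + e" using l(1) by (simp add: e_def)
  define q where "q = int p ^ e"
  have q: "0 < q" by (simp add: q_def)
  define r where "r = (s + D k e) mod q"
  have r0: "0 \<le> r" using q by (simp add: r_def)
  define Z where "Z = n + D 0 l"
  have ZP: "Z div P = s + D k e"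
    using P by (simp add: Z_def le D_add s_def pos_def P_def[symmetric] add.assoc[symmetric])
  have Pq: "int p ^ l = P * q" by (simp add: le power_add P_def q_def)
  have anc: "(s + D k e) div q = pos n l"
    using q P unfolding ZP[symmetric] pos_def Z_def[symmetric] Pq by (simp add: zdiv_zmult2_eq)
  have rB: "r + B < q"
  proof -
    have "Z mod (P * q) = P * r + Z mod P"
      using q by (simp add: zmod_zmult2_eq ZP r_def)
    moreover have "P * B \<le> P * q - 1 - Z mod (P * q)"
      using rm unfolding room_def Z_def[symmetric] Pq .
    ultimately have "P * (r + B) < P * q"
      using pos_mod_sign[OF P, of Z] by (simp add: algebra_simps)
    then show ?thesis using P by simp
  qed
  have letters: "X k (s + h) = iterate \<tau> e a ! nat (r + h)" "Y k (s + h) = iterate \<tau> e b ! nat (r + h)"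
    if h: "0 \<le> h" "h \<le> B" for h
  proof -
    have eq: "s + h + D k e = (r + h) + q * pos n l"
      using mult_div_mod_eq[of q "s + D k e"] unfolding anc r_def[symmetric] by simp
    have "(s + h + D k e) div q = pos n l" "(s + h + D k e) mod q = r + h"
      unfolding eq using r0 rB h q by simp_all
    moreover have "X k = inflate e (D k e) (X l)" "Y k = inflate e (D k e) (Y l)"
      using D[of k e] by (simp_all add: le)
    ultimately show "X k (s + h) = iterate \<tau> e a ! nat (r + h)" "Y k (s + h) = iterate \<tau> e b ! nat (r + h)"
      using S'(1,2)[OF l(2)] by (simp_all add: inflate_def q_def)
  qed
  have nat_q: "nat (r + h) < p ^ e" if "0 \<le> h" "h \<le> B" for h
    using that r0 rB by (simp add: nat_less_iff q_def)
  have "iterate \<tau> e a ! nat r = a" "iterate \<tau> e b ! nat r = b"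
    using letters[of 0] S'(1,2)[OF k] h1 by (simp_all add: s_def B_def)
  moreover have "iterate \<tau> e a ! nat (r + h1) \<noteq> iterate \<tau> e b ! nat (r + h1)"
      "iterate \<tau> e a ! nat (r + h2) = iterate \<tau> e b ! nat (r + h2)"
    using letters[of h1] letters[of h2] h1 h2 by (simp_all add: B_def)
  moreover have "nat r < nat (r + h1)" "nat r < nat (r + h2)" using r0 h1(1) h2(1) by simp_all
  moreover have "nat (r + h1) < p ^ e" "nat (r + h2) < p ^ e"
    using nat_q[of h1] nat_q[of h2] h1(1) h2(1) by (simp_all add: B_def)
  ultimately show ?thesis using \<open>a \<noteq> b\<close> by blast
qed

end

section \<open>Characterization of Li--Yorke pairs\<close>

lemma marked_splitting_iff:
  assumes len: "length w = length w'"
  shows "(\<exists>u u' v v'. w = u @ [a] @ v \<and> w' = u' @ [b] @ v' \<and> length u = length u' \<and>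
       length v = length v' \<and> v \<noteq> v' \<and> (\<exists>i<length v. v ! i = v' ! i)) \<longleftrightarrow>
    (\<exists>r j k. r < j \<and> j < length w \<and> r < k \<and> k < length w \<and> w ! r = a \<and> w' ! r = b \<and>
       w ! j \<noteq> w' ! j \<and> w ! k = w' ! k)" (is "?words \<longleftrightarrow> ?positions")
proof
  assume ?words
  then obtain u u' v v' i where w: "w = u @ [a] @ v" "w' = u' @ [b] @ v'"
    and l: "length u = length u'" "length v = length v'"
    and ne: "v \<noteq> v'" and i: "i < length v" "v ! i = v' ! i" by blast
  obtain j where j: "j < length v" "v ! j \<noteq> v' ! j" using ne l(2) nth_equalityI by blast
  have nth: "w ! (length u + 1 + t) = v ! t" "w' ! (length u + 1 + t) = v' ! t" for t
    by (simp_all add: w l(1) nth_append)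
  have "w ! length u = a" by (simp add: w(1))
  moreover have "w' ! length u = b" by (simp add: w(2) l(1))
  moreover have "w ! (length u + 1 + j) \<noteq> w' ! (length u + 1 + j)"
      "w ! (length u + 1 + i) = w' ! (length u + 1 + i)"
    unfolding nth using i j by simp_all
  moreover have "length u + 1 + j < length w" "length u + 1 + i < length w"
    using i j by (simp_all add: w)
  moreover have "length u < length u + 1 + j" "length u < length u + 1 + i" by simp_all
  ultimately show ?positions by blast
next
  assume ?positions
  then obtain r j k where r: "r < j" "j < length w" "r < k" "k < length w"
    and ab: "w ! r = a" "w' ! r = b" and j: "w ! j \<noteq> w' ! j" and k: "w ! k = w' ! k" by blast
  have w: "w = take r w @ [a] @ drop (Suc r) w"
    using r ab(1) id_take_nth_drop[of r w] by simp
  have w': "w' = take r w' @ [b] @ drop (Suc r) w'"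
    using r ab(2) id_take_nth_drop[of r w'] len by simp
  have nth: "drop (Suc r) w ! (t - Suc r) = w ! t" "drop (Suc r) w' ! (t - Suc r) = w' ! t"
    if "r < t" "t < length w" for t using that len by simp_all
  have "drop (Suc r) w \<noteq> drop (Suc r) w'" using j nth[OF r(1,2)] by metis
  moreover have "k - Suc r < length (drop (Suc r) w)" using r by simp
  moreover have "drop (Suc r) w ! (k - Suc r) = drop (Suc r) w' ! (k - Suc r)"
    using k nth[OF r(3,4)] by simp
  moreover have "length (take r w) = length (take r w')"
      "length (drop (Suc r) w) = length (drop (Suc r) w')" using len by simp_all
  ultimately show ?words using w w' by blast
qed

theorem proposition3p5:
  fixes \<tau> :: "'a::finite substitution"
    and p :: nat
    and \<rho> :: "(int \<Rightarrow> 'a) \<Rightarrow> (int \<Rightarrow> 'a) \<Rightarrow> real"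
  assumes "is_substitution \<tau>"
    and "inj \<tau>"
    and "primitive \<tau>"
    and "p \<ge> 2"
    and "constant_length \<tau> p"
    and "infinite (substitution_subshift \<tau>)"
    and "compatible_metric (substitution_subshift \<tau>) \<rho>"
  shows "(\<exists>x\<in>substitution_subshift \<tau>. \<exists>y\<in>substitution_subshift \<tau>. Li_Yorke_pair \<rho> x y) \<longleftrightarrow>
    (\<exists>(m::nat) a b u u' v v'. a \<noteq> b \<and>
       iterate \<tau> m a = u @ [a] @ v \<and> iterate \<tau> m b = u' @ [b] @ v' \<and>
       length u = length u' \<and> length v = length v' \<and>
       v \<noteq> v' \<and> (\<exists>i<length v. v ! i = v' ! i))"
    (is "?pairs \<longleftrightarrow> ?words")
proof -
  interpret uniform_substitution \<tau> p
    using assms(2-5) by unfold_locales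
  have inf: "infinite points" and \<rho>: "compatible_metric points \<rho>"
    using assms(6,7) unfolding substitution_subshift_eq_points by simp_all
  have "?pairs \<longleftrightarrow> (\<exists>x\<in>points. \<exists>y\<in>points. forward_Li_Yorke x y)"
    unfolding substitution_subshift_eq_points
    using Li_Yorke_pair_iff[OF subshift_points \<rho>] by blast
  also have "\<dots> \<longleftrightarrow> (\<exists>m a b. a \<noteq> b \<and> (\<exists>r j k. r < j \<and> j < p ^ m \<and> r < k \<and> k < p ^ m \<and>
      iterate \<tau> m a ! r = a \<and> iterate \<tau> m b ! r = b \<and>
      iterate \<tau> m a ! j \<noteq> iterate \<tau> m b ! j \<and> iterate \<tau> m a ! k = iterate \<tau> m b ! k))"
    (is "_ \<longleftrightarrow> ?letters")
  proof
    assume "\<exists>x\<in>points. \<exists>y\<in>points. forward_Li_Yorke x y"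
    then show ?letters using letters_from_forward_Li_Yorke[OF inf] by meson
  next
    assume ?letters
    then show "\<exists>x\<in>points. \<exists>y\<in>points. forward_Li_Yorke x y"
      using forward_Li_Yorke_from_letters by meson
  qed
  also have "\<dots> \<longleftrightarrow> (\<exists>m a b. a \<noteq> b \<and> (\<exists>u u' v v'.
      iterate \<tau> m a = u @ [a] @ v \<and> iterate \<tau> m b = u' @ [b] @ v' \<and> length u = length u' \<and>
      length v = length v' \<and> v \<noteq> v' \<and> (\<exists>i<length v. v ! i = v' ! i)))"
    by (subst marked_splitting_iff) (simp_all only: length_iterate)
  also have "\<dots> \<longleftrightarrow> ?words" by blast
  finally show ?thesis .
qed

end
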